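(* Let $\eta=(\eta_i)_{i\in\mathbb{N}}$ be a sequence of independent random variables, with $\eta_i$ uniformly distributed on $(0,1)$ for all $i\in\mathbb{N}$. (a) The algorithm $\mathrm{RT}$ generates the Harris chain associated with random recursive trees, in the sense that the sequence $\mathrm{RT}(\eta)$ and the Harris chain $X=(X_n)_{n\in\mathbb{N}}$ are identical in distribution. (b) Suppose that $X=\mathrm{RT}(\eta)$. Then $X_n$ converges almost surely to a limit $X_\infty$ in the Doob-Martin topology as $n\to\infty$, where on a set of probability $1$ the limit $X_\infty$ is given by $$X_\infty(A_u)=\eta_{(\tau(u):\kappa(u)+1)}-\eta_{\tau(u)}\quad\text{for all }u\in\mathbb{V}.$$
   Context: Harris trees. $\mathbb{N}=\{1,2,\ldots\}$, $\mathbb{N}_0=\mathbb{N}\cup\{0\}$, and $\mathbb{V}=\mathbb{N}^\star$ is the set of finite sequences of natural numbers (including the empty sequence $\emptyset$). $u+v$ denotes concatenation and $ui:=u+(i)$. A Harris tree is a finite nonempty set $x\subset\mathbb{V}$ such that (i) $u+v\in x$ implies $u\in x$, and (ii) $ui\in x$ with $i>1$ implies $uj\in x$ for $j=1,\ldots,i-1$. $\mathbb{H}$ is the set of Harris trees, $\mathbb{H}_n$ the set of those with $n$ nodes. For $x\in\mathbb{H}$ and $u\in\mathbb{V}$, $x(u):=\{v\in\mathbb{V}: u+v\in x\}$. Harris chain. A recursive tree on $\{1,\ldots,n\}$ is a tree rooted at $1$ such that node numbers increase along every path from the root. The random recursive tree (RRT) chain $(Y_n)_{n\in\mathbb{N}}$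 starts with the tree consisting of the root $1$ only; $Y_{n+1}$ is obtained from $Y_n$ by joining node $n+1$ to a node chosen uniformly at random from $\{1,\ldots,n\}$ (independently of the past). The map $\Psi$ sends a recursive tree to the Harris tree obtained by assigning to node $j$ the word $(u_1(j),\ldots,u_k(j))$, where $k$ is the distance of $j$ to the root, $u_k(j)$ is the number of nodes $i\in\{1,\ldots,j\}$ that have the same direct ancestor as $j$, and the prefixes similarly encode the nodes on the path from the root to $j$. The Harris chain is $X_n:=\Psi(Y_n)$, $n\in\mathbb{N}$. Equivalently, $X$ is the Markov chain with $X_1=\{\emptyset\}$ and, for $x_n\in\mathbb{H}_n$, $x_{n+1}\in\mathbb{H}_{n+1}$, $P(X_{n+1}=x_{n+1}\mid X_n=x_n)=1/n$ if $x_n\subset x_{n+1}$ and $0$ otherwise. Doob-Martin topology. $\bar{\mathbb{V}}:=\mathbb{N}^\star\sqcup\mathbb{N}^\infty\sqcup\bigsqcup_{k=0}^\infty\mathbb{N}^k\times\{\infty\}^\infty$; for $u\in\mathbb{V}$, $A_u:=\{v\in\bar{\mathbb{V}}: u\text{ is a prefix of }v\}$; $\mathcal{V}$ is the $\sigma$-field on $\bar{\mathbb{V}}$ generated by the sets $A_u$, $u\in\mathbb{V}$. $\bar{\mathbb{H}}$ is the set of probability measures $\mu$ on $(\bar{\mathbb{V}},\mathcal{V})$, with the coarsest topology that makes all maps $\mu\mapsto\mu(A_u)$, $u\in\mathbb{V}$, continuous (the Doob-Martin topology). A tree $x\in\mathbb{H}$ is identified with the uniform distribution on its nodes, so that $A_u$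 has mass $\#x(u)/\#x$. Thus, for $x_n\in\mathbb{H}_n$, convergence of $x_n$ to $\mu\in\bar{\mathbb{H}}$ means $\frac1n\#x_n(u)\to\mu(A_u)$ for all $u\in\mathbb{V}$. The algorithm $\mathrm{RT}$. The input is a sequence $t=(t_n)_{n\in\mathbb{N}}$ of pairwise distinct positive reals (for random input it suffices that this holds with probability $1$). It produces labelled trees $(x_n,\phi_n)$, $x_n\in\mathbb{H}_n$, $\phi_n:x_n\to\mathbb{R}$. Start with $x_1=\{\emptyset\}$ and label $\phi_1(\emptyset)=t_0:=0$. In the step from $x_n$ to $x_{n+1}$, let $w\in x_n$ be the node with label $\max\{t_j: j=0,\ldots,n-1,\ t_j<t_n\}$; add to $x_n$ the new node $v=wi$, where $i-1$ is the number of children of $w$ in $x_n$, and give $v$ the label $t_n$; other labels are unchanged. $\mathrm{RT}(t):=(x_n)_{n\in\mathbb{N}}$. Notation for the limit. For input $t$ in $(0,1)$ with output $(x_n)$ let $0=:t_{(n:0)}<t_{(n:1)}<\cdots<t_{(n:n)}<t_{(n:n+1)}:=1$ be the augmented increasing order statistics of $t_1,\ldots,t_n$. For $u\in\mathbb{V}$ let $\tau(u):=\inf\{n\in\mathbb{N}_0: u\in x_{n+1}\}$ and $\kappa(u):=\#\{1\le i\le\tau(u): t_i\le t_{\tau(u)}\}$. In particular $\tau(\emptyset)=\kappa(\emptyset)=0$, $t_{(0:1)}=1$. In part (b) these are used with $t=\eta$ and $\eta_0:=0$; with probability $1$ all $\tau(u)$ are finite. *)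

theory Defs
  imports "HOL-Probability.Probability"
begin

section \<open>Words and Harris trees\<close>

text \<open>The alphabet is \<open>{1, 2, \<dots>}\<close>, so words are lists of positive naturals.\<close>

definition words :: "nat list set" where
  "words = lists {1..}"

definition harris_trees :: "nat list set set" where
  "harris_trees = {x. finite x \<and> x \<noteq> {} \<and> x \<subseteq> words \<and>
     (\<forall>u v. u @ v \<in> x \<longrightarrow> u \<in> x) \<and>
     (\<forall>u i. u @ [i] \<in> x \<and> i > 1 \<longrightarrow> (\<forall>j\<in>{1..i - 1}. u @ [j] \<in> x))}"

section \<open>The Harris chain\<close>

text \<open>
  A recursive tree on \<open>{1..n}\<close> is represented by its set of edges, each edge written as
  (direct ancestor, node). The edge set of the tree consisting of the root 1 only is empty.

  The relation \<open>node_word E j w\<close> says that node \<open>j\<close> is assigned the word \<open>w\<close>; the last letter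
  counts the nodes up to and including \<open>j\<close> with the same direct ancestor as \<open>j\<close>.
\<close>

inductive node_word :: "(nat \<times> nat) set \<Rightarrow> nat \<Rightarrow> nat list \<Rightarrow> bool"
  for E :: "(nat \<times> nat) set" where
  root: "node_word E 1 []"
| child: "node_word E i w \<Longrightarrow> (i, j) \<in> E \<Longrightarrow> node_word E j (w @ [card {k \<in> {1..j}. (i, k) \<in> E}])"

definition Psi :: "(nat \<times> nat) set \<Rightarrow> nat list set" where
  "Psi E = {w. \<exists>j. node_word E j w}"

text \<open>
  \<open>U n\<close> is the node to which node \<open>n + 1\<close> is joined. Since \<open>Y 1, \<dots>, Y n\<close> and
  \<open>U 1, \<dots>, U (n - 1)\<close> determine each other, choosing \<open>U n\<close> independently of the past for every
  \<open>n\<close> amounts to independence of the sequence \<open>U\<close>. The value \<open>Y 0\<close> plays no role.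
\<close>

definition rrt_chain :: "'b measure \<Rightarrow> (nat \<Rightarrow> 'b \<Rightarrow> (nat \<times> nat) set) \<Rightarrow> bool" where
  "rrt_chain N Y \<longleftrightarrow> prob_space N \<and>
     (\<exists>U. prob_space.indep_vars N (\<lambda>n. count_space {1..n}) U {1..} \<and>
       (\<forall>n\<ge>1. distr N (count_space {1..n}) (U n) = uniform_count_measure {1..n}) \<and>
       (\<forall>\<omega>\<in>space N. Y 1 \<omega> = {} \<and> (\<forall>n\<ge>1. Y (Suc n) \<omega> = insert (U n \<omega>, Suc n) (Y n \<omega>))))"

definition harris_chain :: "'b measure \<Rightarrow> (nat \<Rightarrow> 'b \<Rightarrow> nat list set) \<Rightarrow> bool" where
  "harris_chain N X \<longleftrightarrow>
     (\<exists>Y. rrt_chain N Y \<and> (\<forall>n\<ge>1. \<forall>\<omega>\<in>space N. X n \<omega> = Psi (Y n \<omega>)))"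

text \<open>The space of sequences \<open>(x\<^sub>n)\<close>, \<open>n \<ge> 1\<close>, of Harris trees, with the discrete
  structure on each coordinate.\<close>

definition tree_sequences :: "(nat \<Rightarrow> nat list set) measure" where
  "tree_sequences = (\<Pi>\<^sub>M n\<in>{1..}. count_space harris_trees)"

section \<open>The Doob-Martin topology\<close>

text \<open>\<open>Word\<close> carries the finite words, \<open>Seq\<close> the infinite ones, in which the
  letter \<open>\<infinity>\<close> is allowed.\<close>

datatype extended_word = Word "nat list" | Seq "enat stream"

definition ext_words :: "extended_word set" where
  "ext_words = Word ` words \<union> Seq ` {s. sset s \<subseteq> enat ` {1..}} \<union>
     (\<Union>k. {Seq (map enat v @- sconst \<infinity>) | v. v \<in> words \<and> length v = k})"

fun is_prefix :: "nat list \<Rightarrow> extended_word \<Rightarrow> bool" where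
  "is_prefix u (Word v) \<longleftrightarrow> prefix u v"
| "is_prefix u (Seq s) \<longleftrightarrow> stake (length u) s = map enat u"

definition cyl :: "nat list \<Rightarrow> extended_word set" where
  "cyl u = {v \<in> ext_words. is_prefix u v}"

definition ext_words_algebra :: "extended_word measure" where
  "ext_words_algebra = sigma ext_words (cyl ` words)"

text \<open>The points are the elements of \<open>space (prob_algebra ext_words_algebra)\<close>, i.e. all
  probability measures on \<open>ext_words_algebra\<close>. The sets below are the preimages of the open
  sets under the evaluation maps.\<close>

definition doob_martin :: "extended_word measure topology" where
  "doob_martin = topology_generated_by
     {{\<mu> \<in> space (prob_algebra ext_words_algebra). measure \<mu> (cyl u) \<in> S} | u S.
        u \<in> words \<and> open (S :: real set)}"

definition tree_measure :: "nat list set \<Rightarrow> extended_word measure" where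
  "tree_measure x = distr (uniform_count_measure x) ext_words_algebra Word"

section \<open>The algorithm RT\<close>

text \<open>
  An input \<open>(t\<^sub>n)\<close>, \<open>n \<ge> 1\<close>, is a function on the naturals whose value at 0 is ignored and
  replaced by \<open>t\<^sub>0 = 0\<close>.
\<close>

abbreviation with_zero :: "(nat \<Rightarrow> real) \<Rightarrow> nat \<Rightarrow> real" where
  "with_zero t \<equiv> t(0 := 0)"

text \<open>
  If the \<open>t\<^sub>n\<close>, \<open>n \<ge> 1\<close>, are positive and pairwise distinct, there is exactly one node with the
  given label. For other inputs the choice below merely makes the algorithm total, with
  Harris trees as output.
\<close>

definition labelled_node :: "nat list set \<Rightarrow> (nat list \<Rightarrow> real) \<Rightarrow> real \<Rightarrow> nat list" where
  "labelled_node x \<phi> m =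
     (if \<exists>w\<in>x. \<phi> w = m then SOME w. w \<in> x \<and> \<phi> w = m else [])"

fun rt_step :: "(nat \<Rightarrow> real) \<Rightarrow> nat \<Rightarrow> nat list set \<times> (nat list \<Rightarrow> real)
    \<Rightarrow> nat list set \<times> (nat list \<Rightarrow> real)" where
  "rt_step t n (x, \<phi>) =
     (let w = labelled_node x \<phi> (Max {t j | j. j < n \<and> t j < t n});
          v = w @ [card {i. w @ [i] \<in> x} + 1]
      in (insert v x, \<phi>(v := t n)))"

text \<open>\<open>rt_state t k\<close> is the labelled tree with \<open>k + 1\<close> nodes, so that \<open>RT t n\<close> has \<open>n\<close> nodes
  for \<open>n \<ge> 1\<close>; the value \<open>RT t 0\<close> plays no role.\<close>

primrec rt_state :: "(nat \<Rightarrow> real) \<Rightarrow> nat \<Rightarrow> nat list set \<times> (nat list \<Rightarrow> real)" where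
  "rt_state t 0 = ({[]}, \<lambda>_. 0)"
| "rt_state t (Suc k) = rt_step (with_zero t) (Suc k) (rt_state t k)"

definition RT :: "(nat \<Rightarrow> real) \<Rightarrow> nat \<Rightarrow> nat list set" where
  "RT t n = fst (rt_state t (n - 1))"

definition order_stat :: "(nat \<Rightarrow> real) \<Rightarrow> nat \<Rightarrow> nat \<Rightarrow> real" where
  "order_stat t n k = (0 # sort (map t [1..<Suc n]) @ [1]) ! k"

text \<open>The infimum is taken in the naturals, so \<open>tau t u\<close> is meaningful only if \<open>u\<close> is
  eventually a node of the tree.\<close>

definition tau :: "(nat \<Rightarrow> real) \<Rightarrow> nat list \<Rightarrow> nat" where
  "tau t u = Inf {n. u \<in> RT t (n + 1)}"

definition kappa :: "(nat \<Rightarrow> real) \<Rightarrow> nat list \<Rightarrow> nat" where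
  "kappa t u = card {i \<in> {1..tau t u}. t i \<le> t (tau t u)}"

end

theory Submission
  imports Defs
begin

text \<open>
  Both parts rest on one description of RT for positive, pairwise distinct input. Number the nodes
  \<open>0, 1, 2, \<dots>\<close> in the order of their insertion. Node \<open>n\<close> becomes a child of the node whose label is the
  largest one below \<open>t n\<close> among the earlier labels. If \<open>predecessor t n\<close> denotes that node, then the
  output of RT consists of the Harris codings of the recursive trees with parent function
  \<open>predecessor t\<close>; see \<open>RT_eq_words\<close> and \<open>Psi_eq_words\<close>.

  Part (a). The Harris chain and RT are therefore the same function \<open>tree_sequence\<close> of a sequence of
  attachments. In the Harris chain the attachments are independent and uniform by definition. In RT
  the first \<open>n\<close> attachments determine and are determined by the relative order of
  \<open>\<eta>\<^sub>1, \<dots>, \<eta>\<^sub>n\<close> (\<open>insertion_order_list\<close>). As the sample is exchangeable, all \<open>n!\<close> orders are equally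
  likely (\<open>order_event_prob\<close>), and so are the \<open>n!\<close> sequences of attachments, which means that they are
  independent and uniform as well (\<open>predecessor_uniform\<close>, \<open>uniform_sequence_law\<close>).

  Part (b). When node \<open>m\<close> is inserted, let \<open>b\<close> be the next larger label, or 1 if there is none. All
  descendants of \<open>m\<close>, and no other later nodes, have labels in \<open>[t m, b)\<close> (\<open>prefix_word_iff\<close>), so by
  the strong law of large numbers the relative size of the subtree at \<open>m\<close> tends to \<open>b - t m\<close>
  (\<open>subtree_frequency\<close>), which is the asserted difference of order statistics
  (\<open>order_stat_eq_upper\<close>). As the intervals are random, the strong law is needed for all intervals
  simultaneously; monotonicity reduces this to rational thresholds (\<open>AE_equidistributed\<close>). The same
  fact shows that every node has infinitely many children, so that every word occurs
  (\<open>word_appears\<close>).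

  It remains to see that the limits are the cylinder masses of a probability measure on the extended
  words. The intervals are nested along the tree and disjoint for incomparable nodes. Hence a point
  \<open>s\<close> of \<open>[0, 1)\<close> determines an extended word, whose prefixes are the nodes with interval containing
  \<open>s\<close>, and the uniform distribution is carried to the limit by this map (\<open>exists_limit_measure\<close>).
  Convergence in the Doob-Martin topology is convergence on cylinders (\<open>limitin_doob_martinI\<close>).
\<close>

section \<open>Grafting nodes onto Harris trees\<close>

lemma downclosed_eq_atLeastAtMost_card:
  fixes S :: "nat set"
  assumes "finite S" "0 \<notin> S" and down: "\<And>i j. i \<in> S \<Longrightarrow> 1 \<le> j \<Longrightarrow> j < i \<Longrightarrow> j \<in> S"
  shows "S = {1..card S}"
proof (cases "S = {}")
  case False
  have pos: "1 \<le> i" if "i \<in> S" for i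
    using that assms(2) by (cases i) auto
  have "S = {1..Max S}"
  proof
    show "S \<subseteq> {1..Max S}"
      using assms(1) pos by auto
    show "{1..Max S} \<subseteq> S"
      using down[OF Max_in[OF assms(1) False]] Max_in[OF assms(1) False]
      by (metis atLeastAtMost_iff le_neq_implies_less subsetI)
  qed
  then show ?thesis
    by (metis card_atLeastAtMost diff_Suc_1)
qed simp

text \<open>
  The move by which both RT and a recursive tree grow.
\<close>

definition graft :: "nat list \<Rightarrow> nat list set \<Rightarrow> nat list set" where
  "graft w x = insert (w @ [card {i. w @ [i] \<in> x} + 1]) x"

lemma harris_treesD:
  assumes "x \<in> harris_trees"
  shows "finite x" "x \<noteq> {}" "x \<subseteq> words" "[] \<in> x"
    "\<And>u v. u @ v \<in> x \<Longrightarrow> u \<in> x"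
    "\<And>u i j. u @ [i] \<in> x \<Longrightarrow> 1 \<le> j \<Longrightarrow> j < i \<Longrightarrow> u @ [j] \<in> x"
proof -
  show "finite x" "x \<noteq> {}" "x \<subseteq> words" "\<And>u v. u @ v \<in> x \<Longrightarrow> u \<in> x"
    using assms by (auto simp: harris_trees_def)
  show "[] \<in> x"
    using \<open>x \<noteq> {}\<close> \<open>\<And>u v. u @ v \<in> x \<Longrightarrow> u \<in> x\<close> by (metis append_Nil ex_in_conv)
  show "\<And>u i j. u @ [i] \<in> x \<Longrightarrow> 1 \<le> j \<Longrightarrow> j < i \<Longrightarrow> u @ [j] \<in> x"
    using assms unfolding harris_trees_def by fastforce
qed

lemma harris_children:
  assumes "x \<in> harris_trees"
  shows "{i. w @ [i] \<in> x} = {1..card {i. w @ [i] \<in> x}}"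
proof (rule downclosed_eq_atLeastAtMost_card)
  have "(\<lambda>i. w @ [i]) ` {i. w @ [i] \<in> x} \<subseteq> x" by auto
  then have "finite ((\<lambda>i. w @ [i]) ` {i. w @ [i] \<in> x})"
    using harris_treesD(1)[OF assms] finite_subset by blast
  then show "finite {i. w @ [i] \<in> x}"
    by (rule finite_imageD) (auto simp: inj_on_def)
  show "0 \<notin> {i. w @ [i] \<in> x}"
    using harris_treesD(3)[OF assms] by (auto simp: words_def)
qed (use harris_treesD(6)[OF assms] in auto)

lemma singleton_harris: "{[]} \<in> harris_trees"
  by (auto simp: harris_trees_def words_def)

text \<open>
  The children of \<open>w\<close> carry the letters \<open>1, \<dots>, m\<close> without gap, so the letter \<open>m + 1\<close> of the new
  node leaves no gap either, and the new node has no proper prefix outside the tree.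
\<close>

lemma graft_harris:
  assumes x: "x \<in> harris_trees" and w: "w \<in> x"
  shows "graft w x \<in> harris_trees"
proof -
  define m where "m = card {i. w @ [i] \<in> x}"
  have ch: "w @ [i] \<in> x \<longleftrightarrow> 1 \<le> i \<and> i \<le> m" for i
  proof -
    have "{i. w @ [i] \<in> x} = {1..m}"
      unfolding m_def by (rule harris_children[OF x])
    then have "i \<in> {i. w @ [i] \<in> x} \<longleftrightarrow> i \<in> {1..m}" by (simp only:)
    then show ?thesis by simp
  qed
  note D = harris_treesD[OF x]
  have G: "graft w x = insert (w @ [m + 1]) x"
    by (simp add: graft_def m_def)
  have "u \<in> graft w x" if "u @ v \<in> graft w x" for u v
  proof (cases "u @ v \<in> x")
    case False
    then have "u @ v = w @ [m + 1]" using that by (simp add: G)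
    then have "prefix u w \<or> u = w @ [m + 1]"
      by (metis prefix_def prefix_snoc)
    then show ?thesis
      using D(5) w by (auto simp: G prefix_def)
  qed (use D(5) in \<open>auto simp: G\<close>)
  moreover have "u @ [j] \<in> graft w x" if "u @ [i] \<in> graft w x" "i > 1" "j \<in> {1..i-1}" for u i j
  proof (cases "u @ [i] \<in> x")
    case True
    moreover have "1 \<le> j" "j < i" using that by auto
    ultimately show ?thesis using D(6)[of u i j] by (auto simp: G)
  next
    case False
    then have "u = w" "i = m + 1" using that by (auto simp: G)
    then show ?thesis using ch[of j] that by (auto simp: G)
  qed
  moreover have "graft w x \<subseteq> words"
    using D(3) w by (auto simp: G words_def)
  moreover have "finite (graft w x)" "graft w x \<noteq> {}"
    using D(1) by (auto simp: G)
  ultimately show ?thesis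
    unfolding harris_trees_def by blast
qed

lemma countable_harris_trees: "countable harris_trees"
proof (rule countable_subset)
  show "harris_trees \<subseteq> {x. finite x \<and> x \<subseteq> UNIV}"
    by (auto simp: harris_trees_def)
  show "countable {x :: nat list set. finite x \<and> x \<subseteq> UNIV}"
    by (rule countable_Collect_finite_subset) simp
qed

section \<open>Words of a recursive tree\<close>

text \<open>
  The word that \<open>Psi\<close> assigns to a node of the recursive tree with parent function \<open>p\<close>. Here nodes
  are counted from 0, which matches the indices \<open>t\<^sub>0, t\<^sub>1, \<dots>\<close> of the labels in RT; node \<open>n\<close> is the
  node \<open>n + 1\<close> of \<open>Psi\<close>. The test \<open>n \<le> p n\<close> makes the recursion terminate for every \<open>p\<close>.
\<close>

function word :: "(nat \<Rightarrow> nat) \<Rightarrow> nat \<Rightarrow> nat list" where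
  "word p n = (if n = 0 \<or> n \<le> p n then []
     else word p (p n) @ [card {k \<in> {1..n}. p k = p n}])"
  by auto
termination by (relation "Wellfounded.measure snd") auto

declare word.simps [simp del]

text \<open>
  A word depends on finitely many values of the parent function only. This is what makes the trees
  measurable functions of a random parent function.
\<close>

lemma word_cong:
  assumes "\<And>k. 1 \<le> k \<Longrightarrow> k \<le> n \<Longrightarrow> p k = q k"
  shows "word p n = word q n"
  using assms
proof (induction n rule: less_induct)
  case (less n)
  show ?case
  proof (cases "n = 0 \<or> n \<le> p n")
    case True
    then show ?thesis using less.prems[of n] by (cases "n = 0")
      (simp_all add: word.simps[of p n] word.simps[of q n] word.simps[of p 0] word.simps[of q 0])
  next
    case False
    then have "p n = q n" "p n < n" using less.prems[of n] by auto
    moreover have "word p (p n) = word q (p n)"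
    proof (rule less.IH)
      show "p n < n" by fact
      show "p k = q k" if "1 \<le> k" "k \<le> p n" for k
        using less.prems[of k] that \<open>p n < n\<close> by linarith
    qed
    moreover have "{k \<in> {1..n}. p k = p n} = {k \<in> {1..n}. q k = q n}"
      using less.prems \<open>p n = q n\<close> by auto
    ultimately show ?thesis using False by (simp add: word.simps[of p n] word.simps[of q n])
  qed
qed

locale recursive_tree =
  fixes p :: "nat \<Rightarrow> nat"
  assumes parent_less: "1 \<le> n \<Longrightarrow> p n < n"
begin

abbreviation rank :: "nat \<Rightarrow> nat" where
  "rank n \<equiv> card {k \<in> {1..n}. p k = p n}"

lemma word_0: "word p 0 = []"
  by (subst word.simps) simp

lemma word_pos: "1 \<le> n \<Longrightarrow> word p n = word p (p n) @ [rank n]"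
  using parent_less[of n] by (simp add: word.simps[of p n])

lemma rank_less:
  assumes "1 \<le> m" "m < n" "p m = p n"
  shows "rank m < rank n"
proof (rule psubset_card_mono)
  have "n \<in> {k \<in> {1..n}. p k = p n}" "n \<notin> {k \<in> {1..m}. p k = p m}"
    using assms by auto
  moreover have "{k \<in> {1..m}. p k = p m} \<subseteq> {k \<in> {1..n}. p k = p n}"
    using assms by auto
  ultimately show "{k \<in> {1..m}. p k = p m} \<subset> {k \<in> {1..n}. p k = p n}"
    by blast
qed simp

text \<open>
  Different nodes get different words: dropping the last letter gives the word of the parent, and
  among the children of one parent the last letter strictly increases with the node.
\<close>

lemma word_eq_iff: "word p m = word p n \<longleftrightarrow> m = n"
proof (induction m arbitrary: n rule: less_induct)
  case (less m)
  show ?case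
  proof (cases "1 \<le> m \<and> 1 \<le> n")
    case True
    show ?thesis
    proof
      assume "word p m = word p n"
      then have *: "word p (p m) = word p (p n)" "rank m = rank n"
        using True by (simp_all add: word_pos)
      then have "p m = p n"
        using less.IH[of "p m" "p n"] parent_less True by simp
      then show "m = n"
        using rank_less[of m n] rank_less[of n m] True * by (cases m n rule: linorder_cases) auto
    qed simp
  next
    case False
    then have "m = 0 \<or> n = 0" by auto
    then show ?thesis
      by (cases "m = 0"; cases "n = 0") (auto simp: word_0 word_pos)
  qed
qed

lemma word_children:
  "{i. word p j @ [i] \<in> word p ` {..<n}} = rank ` {k \<in> {1..<n}. p k = j}"
proof -
  have "word p j @ [i] = word p k \<longleftrightarrow> 1 \<le> k \<and> p k = j \<and> i = rank k" for i k
  proof (cases "k = 0")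
    case False
    then show ?thesis using word_pos[of k] word_eq_iff[of j "p k"] by auto
  qed (simp add: word_0)
  then show ?thesis by (simp add: image_iff) fast
qed

text \<open>
  The next free letter at a node can be read off either from the tree, as RT does, or from the
  parent function, as \<open>Psi\<close> does.
\<close>

lemma card_word_children:
  "card {i. word p j @ [i] \<in> word p ` {..<n}} = card {k \<in> {1..<n}. p k = j}"
proof -
  have "inj_on rank {k \<in> {1..<n}. p k = j}"
  proof (rule inj_onI)
    fix k l assume "k \<in> {k \<in> {1..<n}. p k = j}" "l \<in> {k \<in> {1..<n}. p k = j}" "rank k = rank l"
    then show "k = l"
      using rank_less[of k l] rank_less[of l k] by (cases k l rule: linorder_cases) auto
  qed
  then show ?thesis
    unfolding word_children by (rule card_image)
qed

lemma words_Suc: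
  assumes "1 \<le> n"
  shows "word p ` {..<Suc n} = graft (word p (p n)) (word p ` {..<n})"
proof -
  have "{k \<in> {1..n}. p k = p n} = insert n {k \<in> {1..<n}. p k = p n}"
    using assms by auto
  then have "rank n = card {i. word p (p n) @ [i] \<in> word p ` {..<n}} + 1"
    by (simp only: card_word_children) (simp add: card_insert_if)
  then show ?thesis
    using assms by (simp add: graft_def lessThan_Suc word_pos)
qed

lemma words_harris: "1 \<le> n \<Longrightarrow> word p ` {..<n} \<in> harris_trees"
proof (induction n rule: dec_induct)
  case base
  show ?case by (simp add: lessThan_Suc word_0 singleton_harris)
next
  case (step n)
  then show ?case
    unfolding words_Suc[OF step(1)] using parent_less[of n] by (intro graft_harris) auto
qed

text \<open>
  A prefix of the word of \<open>n\<close> is the word of an ancestor of \<open>n\<close>, and ancestors are older.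
\<close>

lemma prefix_word_imp_le: "prefix (word p m) (word p n) \<Longrightarrow> m \<le> n"
proof (induction n rule: less_induct)
  case (less n)
  show ?case
  proof (cases "m = n \<or> n = 0")
    case True
    then show ?thesis
      using less.prems word_eq_iff[of m 0] by (auto simp: word_0)
  next
    case False
    then have "prefix (word p m) (word p (p n))"
      using less.prems word_eq_iff[of m n] by (simp add: word_pos)
    then show ?thesis
      using less.IH[of "p n"] parent_less[of n] False by simp
  qed
qed

text \<open>
  The inductive relation behind \<open>Psi\<close> follows the path from the root to a node, as the recursion
  for \<open>word\<close> does; the successors are the shift between counting nodes from 1 and from 0.
\<close>

lemma Psi_eq_words:
  assumes "1 \<le> n"
  shows "Psi {(Suc (p k), Suc k) | k. 1 \<le> k \<and> k < n} = word p ` {..<n}"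
proof -
  define E where "E = {(Suc (p k), Suc k) | k. 1 \<le> k \<and> k < n}"
  have E: "(i, j) \<in> E \<longleftrightarrow> (\<exists>k. 1 \<le> k \<and> k < n \<and> i = Suc (p k) \<and> j = Suc k)" for i j
    by (auto simp: E_def)
  have rank: "card {l \<in> {1..Suc k}. (Suc (p k), l) \<in> E} = rank k" if "k < n" for k
  proof -
    have "{l \<in> {1..Suc k}. (Suc (p k), l) \<in> E} = Suc ` {l \<in> {1..k}. p l = p k}"
      using that by (auto simp: E)
    then show ?thesis by (simp add: card_image)
  qed
  have sound: "\<exists>k<n. j = Suc k \<and> w = word p k" if "node_word E j w" for j w
    using that
  proof induction
    case root
    then show ?case using assms by (auto simp: word_0)
  next
    case (child i w j)
    then obtain k where "k < n" "1 \<le> k" "i = Suc (p k)" "j = Suc k" "w = word p (p k)"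
      by (auto simp: E)
    then have "w @ [card {k \<in> {1..j}. (i, k) \<in> E}] = word p k"
      using rank[of k] word_pos[of k] by simp
    then show ?case using \<open>k < n\<close> \<open>j = Suc k\<close> by blast
  qed
  have complete: "node_word E (Suc k) (word p k)" if "k < n" for k
    using that
  proof (induction k rule: less_induct)
    case (less k)
    show ?case
    proof (cases "k = 0")
      case True
      then show ?thesis using node_word.root[of E] by (simp add: word_0)
    next
      case False
      then have "node_word E (Suc (p k)) (word p (p k))" "(Suc (p k), Suc k) \<in> E"
        using less parent_less[of k] by (auto simp: E)
      from node_word.child[OF this] show ?thesis
        using rank[OF less.prems] False by (simp add: word_pos)
    qed
  qed
  show ?thesis
    unfolding Psi_def E_def[symmetric]
  proof (intro set_eqI iffI)
    show "w \<in> word p ` {..<n}" if "w \<in> {w. \<exists>j. node_word E j w}" for w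
      using that sound by fast
    show "w \<in> {w. \<exists>j. node_word E j w}" if "w \<in> word p ` {..<n}" for w
      using that complete by fast
  qed
qed

end

section \<open>The trees of RT\<close>

text \<open>
  RT looks for the label just below \<open>t n\<close> among the earlier labels. The index of that label is the
  parent of node \<open>n\<close>.
\<close>

definition is_predecessor :: "(nat \<Rightarrow> real) \<Rightarrow> nat \<Rightarrow> nat \<Rightarrow> bool" where
  "is_predecessor t n j \<longleftrightarrow> j < n \<and> t j < t n \<and> (\<forall>i<n. t i < t n \<longrightarrow> t i \<le> t j)"

text \<open>
  If no earlier label is smaller, which can occur only for input that is not positive, the root 0
  is taken, so that every input defines a recursive tree.
\<close>

definition predecessor :: "(nat \<Rightarrow> real) \<Rightarrow> nat \<Rightarrow> nat" where
  "predecessor t n = (if \<exists>j. is_predecessor t n j then LEAST j. is_predecessor t n j else 0)"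

lemma recursive_tree_predecessor: "recursive_tree (predecessor t)"
proof
  fix n :: nat assume "1 \<le> n"
  moreover have "is_predecessor t n (LEAST j. is_predecessor t n j)" if "\<exists>j. is_predecessor t n j"
    using that by (rule LeastI_ex)
  ultimately show "predecessor t n < n"
    by (auto simp: predecessor_def is_predecessor_def)
qed

lemma labelled_node_in: "[] \<in> x \<Longrightarrow> labelled_node x \<phi> m \<in> x"
  using someI_ex[of "\<lambda>w. w \<in> x \<and> \<phi> w = m"] by (auto simp: labelled_node_def)

lemma fst_rt_state_Suc: "fst (rt_state t (Suc k)) =
  graft (labelled_node (fst (rt_state t k)) (snd (rt_state t k))
    (Max {with_zero t j | j. j < Suc k \<and> with_zero t j < t (Suc k)})) (fst (rt_state t k))"
  by (cases "rt_state t k") (simp add: graft_def Let_def)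

lemma rt_state_harris: "fst (rt_state t k) \<in> harris_trees"
proof (induction k)
  case 0
  show ?case by (simp add: singleton_harris)
next
  case (Suc k)
  then show ?case
    unfolding fst_rt_state_Suc
    by (intro graft_harris labelled_node_in) (auto dest: harris_treesD(4))
qed

lemma RT_harris: "RT t n \<in> harris_trees"
  by (simp add: RT_def rt_state_harris)

locale distinct_input =
  fixes t :: "nat \<Rightarrow> real"
  assumes t_0: "t 0 = 0" and t_pos: "1 \<le> n \<Longrightarrow> 0 < t n" and t_inj: "t m = t n \<longleftrightarrow> m = n"
begin

abbreviation pre :: "nat \<Rightarrow> nat" where
  "pre \<equiv> predecessor t"

abbreviation W :: "nat \<Rightarrow> nat list" where
  "W \<equiv> word (predecessor t)"

sublocale recursive_tree pre
  by (rule recursive_tree_predecessor)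

lemma is_predecessor_pre:
  assumes "1 \<le> n"
  shows "is_predecessor t n (pre n)"
proof -
  define S where "S = t ` {j. j < n \<and> t j < t n}"
  have S: "finite S" "0 \<in> S"
    using assms t_0 t_pos[of n] unfolding S_def by force+
  then have "Max S \<in> S" by (intro Max_in) auto
  then obtain j where "j < n" "t j < t n" "t j = Max S" by (auto simp: S_def)
  then have "is_predecessor t n j"
    using S(1) by (auto simp: is_predecessor_def S_def)
  then show ?thesis
    unfolding predecessor_def by (auto intro: LeastI)
qed

lemma pre_less: "1 \<le> n \<Longrightarrow> t (pre n) < t n"
  and pre_maximal: "i < n \<Longrightarrow> t i < t n \<Longrightarrow> t i \<le> t (pre n)"
  using is_predecessor_pre[of n] by (auto simp: is_predecessor_def)

lemma pre_eqI:
  assumes "j < n" "t j < t n" "\<And>i. i < n \<Longrightarrow> t i < t n \<Longrightarrow> t i \<le> t j"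
  shows "pre n = j"
proof -
  have "t (pre n) \<le> t j"
    using assms(1,3) pre_less[of n] parent_less[of n] by simp
  moreover have "t j \<le> t (pre n)"
    using assms by (intro pre_maximal)
  ultimately show ?thesis
    using t_inj by (metis order_antisym)
qed

lemma Max_below:
  assumes "1 \<le> n"
  shows "Max {t j | j. j < n \<and> t j < t n} = t (pre n)"
proof (rule Max_eqI)
  have "{t j | j. j < n \<and> t j < t n} \<subseteq> t ` {..<n}" by auto
  then show "finite {t j | j. j < n \<and> t j < t n}"
    by (rule finite_subset) simp
  show "t (pre n) \<in> {t j | j. j < n \<and> t j < t n}"
    using assms parent_less[of n] pre_less[of n] by auto
  show "\<And>y. y \<in> {t j | j. j < n \<and> t j < t n} \<Longrightarrow> y \<le> t (pre n)"
    using pre_maximal by auto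
qed

text \<open>
  Distinct labels identify nodes, so the node found by its label is the word of the predecessor, and
  RT builds the recursive tree with parent function \<open>predecessor t\<close> in its Harris coding.
\<close>

lemma rt_state_eq:
  assumes s: "with_zero s = t"
  shows "fst (rt_state s k) = W ` {..<Suc k} \<and> (\<forall>j\<le>k. snd (rt_state s k) (W j) = t j)"
proof (induction k)
  case 0
  show ?case by (simp add: word_0 t_0 lessThan_Suc)
next
  case (Suc k)
  define x \<phi> where "x = fst (rt_state s k)" and "\<phi> = snd (rt_state s k)"
  have x: "x = W ` {..<Suc k}" and \<phi>: "\<And>j. j \<le> k \<Longrightarrow> \<phi> (W j) = t j"
    using Suc by (simp_all add: x_def \<phi>_def)
  have step: "rt_state s (Suc k) = rt_step t (Suc k) (x, \<phi>)"
    unfolding x_def \<phi>_def by (simp add: s)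
  define m where "m = pre (Suc k)"
  have m: "m \<le> k" using parent_less[of "Suc k"] by (simp add: m_def)
  have node: "labelled_node x \<phi> (Max {t j | j. j < Suc k \<and> t j < t (Suc k)}) = W m"
  proof -
    have "\<exists>w\<in>x. \<phi> w = t m"
      using m \<phi> by (auto simp: x)
    moreover have "(SOME w. w \<in> x \<and> \<phi> w = t m) = W m"
      using m \<phi> t_inj by (intro some_equality) (auto simp: x less_Suc_eq_le)
    ultimately show ?thesis
      using Max_below[of "Suc k"] by (simp add: labelled_node_def m_def)
  qed
  have v: "W m @ [card {i. W m @ [i] \<in> x} + 1] = W (Suc k)"
  proof -
    have "{l \<in> {1..Suc k}. pre l = m} = insert (Suc k) {l \<in> {1..<Suc k}. pre l = m}"
      by (auto simp: m_def)
    then have "rank (Suc k) = card {i. W m @ [i] \<in> x} + 1"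
      unfolding x card_word_children by (simp add: m_def card_insert_if)
    then show ?thesis
      using word_pos[of "Suc k"] by (simp add: m_def)
  qed
  have "rt_state s (Suc k) = (insert (W (Suc k)) x, \<phi>(W (Suc k) := t (Suc k)))"
    unfolding step rt_step.simps Let_def node v ..
  then show ?case
    using x \<phi> by (auto simp: lessThan_Suc le_Suc_eq word_eq_iff)
qed

lemma RT_eq_words:
  assumes "with_zero s = t" "1 \<le> n"
  shows "RT s n = W ` {..<n}"
  using rt_state_eq[OF assms(1), of "n - 1"] assms(2) by (simp add: RT_def)

lemma RT_input_eq_words: "1 \<le> n \<Longrightarrow> RT t n = W ` {..<n}"
  by (rule RT_eq_words) (auto simp: t_0 fun_eq_iff)

lemma tau_word: "tau t (W m) = m"
proof -
  have "{n. W m \<in> RT t (n + 1)} = {m..}"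
    by (auto simp: RT_input_eq_words word_eq_iff)
  then show ?thesis
    unfolding tau_def by (auto intro: cInf_eq_minimum)
qed

end

section \<open>The interval of a node\<close>

locale unit_input = distinct_input +
  assumes t_less_1: "t n < 1"
begin

text \<open>
  The label that follows \<open>t m\<close> in the order of \<open>t\<^sub>0, \<dots>, t\<^sub>n\<close>, with 1 as the end of the range. For
  \<open>n = m\<close> it is the right end of the interval of labels below node \<open>m\<close>; for later \<open>n\<close> it marks where
  the next child of \<open>m\<close> has to fall.
\<close>

definition next_label :: "nat \<Rightarrow> nat \<Rightarrow> real" where
  "next_label n m = Min (insert 1 (t ` {i. i \<le> n \<and> t m < t i}))"

lemma next_label_cases: "next_label n m = 1 \<or> (\<exists>i\<le>n. next_label n m = t i \<and> t m < t i)"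
proof -
  have "next_label n m \<in> insert 1 (t ` {i. i \<le> n \<and> t m < t i})"
    unfolding next_label_def by (intro Min_in) auto
  then show ?thesis by auto
qed

lemma less_next_label: "t m < next_label n m"
  using next_label_cases[of n m] t_less_1[of m] by auto

lemma next_label_le: "i \<le> n \<Longrightarrow> t m < t i \<Longrightarrow> next_label n m \<le> t i"
  unfolding next_label_def by (intro Min_le) auto

lemma next_label_le_1: "next_label n m \<le> 1"
  unfolding next_label_def by (intro Min_le) auto

lemma t_nonneg: "0 \<le> t n"
  using t_0 t_pos[of n] by (cases n) auto

abbreviation upper :: "nat \<Rightarrow> real" where
  "upper m \<equiv> next_label m m"

text \<open>
  The key to the limit: the descendants of \<open>m\<close> are the later nodes with label between \<open>t m\<close> and the
  next label at the time when \<open>m\<close> was inserted. By induction it suffices to compare a node with its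
  parent. The parent carries the label just below the new one, and both ends of the interval are
  older labels (or 1), so the new label cannot be separated from that of its parent by an end of the
  interval. A parent older than \<open>m\<close> with label in the interval would have been the next label.
\<close>

lemma prefix_word_iff:
  assumes "m \<le> n"
  shows "prefix (W m) (W n) \<longleftrightarrow> t m \<le> t n \<and> t n < upper m"
  using assms
proof (induction n rule: less_induct)
  case (less n)
  show ?case
  proof (cases "m = n")
    case True
    then show ?thesis using less_next_label by simp
  next
    case False
    then have mn: "m < n" "1 \<le> n" using less.prems by auto
    have "prefix (W m) (W n) \<longleftrightarrow> prefix (W m) (W (pre n))"
      using mn word_eq_iff[of m n] by (simp add: word_pos)
    also have "\<dots> \<longleftrightarrow> t m \<le> t n \<and> t n < upper m"
    proof
      assume pf: "prefix (W m) (W (pre n))"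
      then have "m \<le> pre n" by (rule prefix_word_imp_le)
      then have IH: "t m \<le> t (pre n)" "t (pre n) < upper m"
        using less.IH[of "pre n"] pf parent_less[of n] mn by auto
      have "t n < upper m"
      proof (rule ccontr)
        assume "\<not> t n < upper m"
        then obtain i where i: "i \<le> m" "upper m = t i" "t i \<le> t n"
          using next_label_cases[of m m] t_less_1[of n] by force
        then have "t i < t n" using t_inj[of i n] mn by auto
        then have "t i \<le> t (pre n)"
          using i mn by (intro pre_maximal) auto
        then show False using IH i by simp
      qed
      then show "t m \<le> t n \<and> t n < upper m"
        using IH pre_less[of n] mn by simp
    next
      assume n: "t m \<le> t n \<and> t n < upper m"
      then have "t m < t n" using t_inj[of m n] mn by auto
      then have le: "t m \<le> t (pre n)" using mn by (intro pre_maximal) auto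
      have less: "t (pre n) < upper m" using n pre_less[of n] mn by simp
      have "m \<le> pre n"
      proof (rule ccontr)
        assume "\<not> m \<le> pre n"
        then have "upper m \<le> t (pre n)"
          using le t_inj[of m "pre n"] by (intro next_label_le) auto
        then show False using less by simp
      qed
      then show "prefix (W m) (W (pre n))"
        using less.IH[of "pre n"] parent_less[of n] mn le less by simp
    qed
    finally show ?thesis .
  qed
qed

definition subtree_interval :: "nat \<Rightarrow> real set" where
  "subtree_interval m = {t m..<upper m}"

lemma interval_0: "subtree_interval 0 = {0..<1}"
proof -
  have "{i. i \<le> 0 \<and> t 0 < t i} = {}" by auto
  then have "next_label 0 0 = 1" unfolding next_label_def by (simp only: image_empty) simp
  then show ?thesis by (simp add: subtree_interval_def t_0)
qed

lemma intervals_nested: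
  assumes "prefix (W m) (W n)"
  shows "subtree_interval n \<subseteq> subtree_interval m"
proof -
  have "m \<le> n" by (rule prefix_word_imp_le[OF assms])
  then have tn: "t m \<le> t n" "t n < upper m" using prefix_word_iff assms by auto
  have "upper n \<le> upper m"
    using next_label_cases[of m m]
  proof
    assume "\<exists>i\<le>m. upper m = t i \<and> t m < t i"
    then show ?thesis using tn \<open>m \<le> n\<close> next_label_le by fastforce
  qed (simp add: next_label_le_1)
  then show ?thesis using tn by (auto simp: subtree_interval_def)
qed

text \<open>
  Intervals of incomparable nodes are disjoint: if \<open>t n < t m\<close> for an older \<open>m\<close>, the interval of \<open>n\<close>
  ends at \<open>t m\<close> or before.
\<close>

lemma intervals_meet_imp_prefix:
  assumes "m \<le> n" "s \<in> subtree_interval m" "s \<in> subtree_interval n"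
  shows "prefix (W m) (W n)"
proof -
  have "t m \<le> t n"
  proof (rule ccontr)
    assume "\<not> t m \<le> t n"
    then have "upper n \<le> t m" using assms(1) by (intro next_label_le) auto
    then show False using assms by (auto simp: subtree_interval_def)
  qed
  then show ?thesis
    using assms by (auto simp: subtree_interval_def prefix_word_iff)
qed

text \<open>
  In the sorted list of \<open>t\<^sub>1, \<dots>, t\<^sub>m\<close> the values up to \<open>t m\<close> occupy exactly the positions below
  \<open>kappa\<close>, since these positions form an initial segment. Hence the entry at position \<open>kappa\<close> is the
  smallest larger value; if there is none, the index runs into the appended 1. The 1 added to \<open>kappa\<close>
  accounts for the 0 put in front of the list.
\<close>

lemma order_stat_eq_upper: "order_stat t m (kappa t (W m) + 1) = upper m"
proof -
  define xs where "xs = sort (map t [1..<Suc m])"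
  have set_xs: "set xs = t ` {1..m}" by (auto simp: xs_def)
  have dist: "distinct xs"
    using t_inj by (auto simp: xs_def distinct_map inj_on_def)
  have sorted: "sorted xs" by (simp add: xs_def)
  have len: "length xs = m" by (simp add: xs_def)
  define c where "c = card {i \<in> {1..m}. t i \<le> t m}"
  have kappa: "kappa t (W m) = c"
    by (simp add: kappa_def tau_word c_def)
  have c_le: "c \<le> m"
  proof -
    have "c \<le> card {1..m}" unfolding c_def by (rule card_mono) auto
    then show ?thesis by simp
  qed
  have os: "order_stat t m (c + 1) = (if c < m then xs ! c else 1)"
    unfolding order_stat_def xs_def[symmetric] using c_le by (simp add: nth_append len)
  have c_xs: "c = card {x \<in> set xs. x \<le> t m}"
  proof -
    have "{x \<in> set xs. x \<le> t m} = t ` {i \<in> {1..m}. t i \<le> t m}" by (auto simp: set_xs)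
    then show ?thesis
      using t_inj by (simp add: c_def card_image inj_on_def)
  qed
  have c_ind: "c = card {j. j < m \<and> xs ! j \<le> t m}"
  proof -
    have "{x \<in> set xs. x \<le> t m} = (!) xs ` {j. j < m \<and> xs ! j \<le> t m}"
      by (auto simp: set_conv_nth len)
    moreover have "inj_on ((!) xs) {j. j < m \<and> xs ! j \<le> t m}"
      using dist len by (auto simp: inj_on_def nth_eq_iff_index_eq)
    ultimately show ?thesis by (simp add: c_xs card_image)
  qed
  have down: "{j. j < m \<and> xs ! j \<le> t m} = {..<c}"
  proof -
    have "Suc ` {j. j < m \<and> xs ! j \<le> t m} = {1..card (Suc ` {j. j < m \<and> xs ! j \<le> t m})}"
    proof (rule downclosed_eq_atLeastAtMost_card)
      fix i j assume "i \<in> Suc ` {j. j < m \<and> xs ! j \<le> t m}" "1 \<le> j" "j < i"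
      then obtain i' where i': "i = Suc i'" "i' < m" "xs ! i' \<le> t m" by auto
      obtain j' where "j = Suc j'" using \<open>1 \<le> j\<close> by (cases j) auto
      moreover have "xs ! j' \<le> xs ! i'"
        using sorted_nth_mono[OF sorted, of j' i'] i' \<open>j < i\<close> \<open>j = Suc j'\<close> len by simp
      ultimately show "j \<in> Suc ` {j. j < m \<and> xs ! j \<le> t m}"
        using i' \<open>j < i\<close> by auto
    qed auto
    then have *: "Suc ` {j. j < m \<and> xs ! j \<le> t m} = {1..c}"
      by (simp only: card_image[OF inj_on_subset[OF inj_Suc subset_UNIV]] c_ind[symmetric])
    have mem: "j \<in> {j. j < m \<and> xs ! j \<le> t m} \<longleftrightarrow> j < c" for j
    proof -
      have "j \<in> {j. j < m \<and> xs ! j \<le> t m} \<longleftrightarrow> Suc j \<in> Suc ` {j. j < m \<and> xs ! j \<le> t m}"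
        by blast
      also have "\<dots> \<longleftrightarrow> Suc j \<in> {1..c}" by (simp only: *)
      finally show ?thesis by (simp add: Suc_le_eq)
    qed
    show ?thesis
      by (rule set_eqI) (simp only: mem lessThan_iff)
  qed
  have "(if c < m then xs ! c else 1) = upper m"
  proof (cases "c < m")
    case True
    have "\<not> xs ! c \<le> t m"
      using down True by blast
    moreover have "xs ! c \<in> set xs" using True len by simp
    ultimately obtain i where i: "i \<le> m" "xs ! c = t i" "t m < t i"
      by (auto simp: set_xs)
    have "upper m = xs ! c"
      unfolding next_label_def
    proof (rule Min_eqI)
      show "xs ! c \<in> insert 1 (t ` {i. i \<le> m \<and> t m < t i})" using i by auto
      fix y assume "y \<in> insert 1 (t ` {i. i \<le> m \<and> t m < t i})"
      then consider "y = 1" | l where "l \<le> m" "t m < t l" "y = t l" by auto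
      then show "xs ! c \<le> y"
      proof cases
        case 1
        then show ?thesis using i t_less_1[of i] by simp
      next
        case 2
        then have "1 \<le> l" using t_nonneg[of m] t_0 by (cases l) auto
        then obtain k where k: "k < m" "xs ! k = y"
          using 2 len set_xs by (metis atLeastAtMost_iff image_eqI in_set_conv_nth)
        then have "k \<notin> {..<c}" unfolding down[symmetric] using 2 by auto
        then show ?thesis
          using sorted_nth_mono[OF sorted, of c k] k len by simp
      qed
    qed simp
    then show ?thesis using True by simp
  next
    case False
    then have "{j. j < m \<and> xs ! j \<le> t m} = {..<m}" using down c_le by simp
    then have below: "x \<le> t m" if "x \<in> set xs" for x
      using that len by (auto simp: set_conv_nth)
    have "\<not> t m < t i" if "i \<le> m" for i
    proof (cases "i = 0")
      case True
      then show ?thesis using t_nonneg[of m] t_0 by simp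
    next
      case False
      then show ?thesis using that below[of "t i"] by (simp add: set_xs)
    qed
    then have "{i. i \<le> m \<and> t m < t i} = {}" by blast
    then have "upper m = 1" unfolding next_label_def by (simp only: image_empty) simp
    then show ?thesis using False by simp
  qed
  then show ?thesis by (simp only: kappa os)
qed

end

section \<open>Equidistributed input\<close>

locale equidistributed_input = unit_input +
  assumes equidistributed: "\<And>x. 0 \<le> x \<Longrightarrow> x \<le> 1 \<Longrightarrow>
    (\<lambda>n. real (card {j. j < n \<and> t j < x}) / real n) \<longlonglongrightarrow> x"
begin

lemma interval_frequency:
  assumes "0 \<le> a" "a \<le> b" "b \<le> 1"
  shows "(\<lambda>n. real (card {j. j < n \<and> a \<le> t j \<and> t j < b}) / real n) \<longlonglongrightarrow> b - a"
proof -
  have "card {j. j < n \<and> t j < b} =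
      card {j. j < n \<and> a \<le> t j \<and> t j < b} + card {j. j < n \<and> t j < a}" for n
  proof -
    have split: "{j. j < n \<and> t j < b} =
        {j. j < n \<and> a \<le> t j \<and> t j < b} \<union> {j. j < n \<and> t j < a}"
      using assms by auto
    show ?thesis
      unfolding split by (rule card_Un_disjoint) auto
  qed
  then have "real (card {j. j < n \<and> a \<le> t j \<and> t j < b}) =
      real (card {j. j < n \<and> t j < b}) - real (card {j. j < n \<and> t j < a})" for n
    by simp
  then show ?thesis
    using tendsto_diff[OF equidistributed equidistributed, of b a] assms
    by (simp add: diff_divide_distrib)
qed

text \<open>
  Finitely many labels have frequency 0, but every interval has a positive one. The auxiliary
  point \<open>c\<close> passes from the half-open intervals to the open one.
\<close>

lemma exists_later_label:
  assumes "0 \<le> a" "a < b" "b \<le> 1"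
  shows "\<exists>k>N. a < t k \<and> t k < b"
proof (rule ccontr)
  assume "\<not> (\<exists>k>N. a < t k \<and> t k < b)"
  define c where "c = (a + b) / 2"
  have c: "a < c" "c < b" using assms by (auto simp: c_def)
  have none: "\<not> (c \<le> t j \<and> t j < b)" if "N < j" for j
    using \<open>\<not> _\<close> c that by force
  have "card {j. j < n \<and> c \<le> t j \<and> t j < b} \<le> Suc N" for n
  proof -
    have "{j. j < n \<and> c \<le> t j \<and> t j < b} \<subseteq> {..N}"
      using none not_le by blast
    then show ?thesis using card_mono[of "{..N}"] by fastforce
  qed
  then have bound: "real (card {j. j < n \<and> c \<le> t j \<and> t j < b}) / real n \<le> real (Suc N) / real n" for n
    by (intro divide_right_mono) (simp_all only: of_nat_le_iff of_nat_0_le_iff)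
  have "b - c \<le> 0"
  proof (rule LIMSEQ_le)
    show "(\<lambda>n. real (card {j. j < n \<and> c \<le> t j \<and> t j < b}) / real n) \<longlonglongrightarrow> b - c"
      using c assms by (intro interval_frequency) auto
    show "(\<lambda>n. real (Suc N) / real n) \<longlonglongrightarrow> 0"
      by (rule lim_const_over_n)
  qed (use bound in auto)
  then show False using c by simp
qed

text \<open>
  The first label after time \<open>N\<close> that falls between \<open>t m\<close> and the next label at time \<open>N\<close> has \<open>t m\<close> as
  the largest smaller label, so it belongs to a child of \<open>m\<close>.
\<close>

lemma infinite_children: "infinite {k. 1 \<le> k \<and> pre k = m}"
proof -
  have later: "\<exists>k>N. pre k = m" if "m \<le> N" for N
  proof -
    have ex: "\<exists>k. N < k \<and> t m < t k \<and> t k < next_label N m"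
      using exists_later_label[of "t m" "next_label N m" N] t_nonneg less_next_label next_label_le_1
      by auto
    \<comment> \<open>The first such label: none of the labels since time \<open>N\<close> lies between \<open>t m\<close> and it.\<close>
    define k where "k = (LEAST k. N < k \<and> t m < t k \<and> t k < next_label N m)"
    have k: "N < k" "t m < t k" "t k < next_label N m"
      using LeastI_ex[OF ex] by (auto simp: k_def)
    have "t i \<le> t m" if "i < k" "t i < t k" for i
    proof (rule ccontr)
      assume "\<not> t i \<le> t m"
      then have "N < i"
        using next_label_le[of i N m] that k by (cases "i \<le> N") auto
      then show False
        using not_less_Least[of i "\<lambda>k. N < k \<and> t m < t k \<and> t k < next_label N m"]
          that k \<open>\<not> t i \<le> t m\<close> by (auto simp: k_def[symmetric])
    qed
    then have "pre k = m"
      using k that by (intro pre_eqI) auto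
    then show ?thesis using k by auto
  qed
  then have "\<exists>k>N. k \<in> {k. 1 \<le> k \<and> pre k = m}" for N
    using later[of "max m N"] by force
  then show ?thesis
    unfolding infinite_nat_iff_unbounded by blast
qed

lemma child_appears:
  assumes "1 \<le> i"
  shows "\<exists>n. W m @ [i] = W n"
proof -
  obtain A where A: "A \<subseteq> {k. 1 \<le> k \<and> pre k = m}" "finite A" "card A = i"
    using infinite_arbitrarily_large[OF infinite_children] by metis
  define n where "n = Suc (Max (insert 0 A))"
  have "A \<subseteq> {k \<in> {1..<n}. pre k = m}"
    using A by (auto simp: n_def less_Suc_eq_le intro: Max_ge)
  then have "i \<le> card {k \<in> {1..<n}. pre k = m}"
    using A(3) card_mono[of "{k \<in> {1..<n}. pre k = m}" A] by simp
  moreover have "W ` {..<n} \<in> harris_trees"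
    by (rule words_harris) (simp add: n_def)
  note harris_children[OF this, of "W m", unfolded card_word_children]
  ultimately have "i \<in> {i. W m @ [i] \<in> W ` {..<n}}"
    using assms by (simp only: atLeastAtMost_iff)
  then show ?thesis by auto
qed

text \<open>
  Every word is the word of some node, since every node eventually has children with all letters.
  So all \<open>tau t u\<close> are honest minima.
\<close>

lemma word_appears:
  assumes "u \<in> words"
  shows "\<exists>m. u = W m"
  using assms
proof (induction u rule: rev_induct)
  case Nil
  show ?case using word_0 by metis
next
  case (snoc i u)
  then show ?case using child_appears[of i] by (auto simp: words_def)
qed

lemma W_in_words: "W n \<in> words"
  using harris_treesD(3)[OF words_harris[of "Suc n"]] by auto

text \<open>
  The subtree at \<open>m\<close> consists of the nodes with label in the interval of \<open>m\<close>, apart from at most \<open>m\<close>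
  nodes that are older than \<open>m\<close>.
\<close>

lemma subtree_frequency:
  "(\<lambda>n. real (card {v \<in> RT t n. prefix (W m) v}) / real n) \<longlonglongrightarrow> upper m - t m"
proof -
  define f g where "f = (\<lambda>n. card {v \<in> RT t n. prefix (W m) v})"
    and "g = (\<lambda>n. card {j. j < n \<and> t m \<le> t j \<and> t j < upper m})"
  have f: "f n = card {j. m \<le> j \<and> j < n \<and> t m \<le> t j \<and> t j < upper m}" if "1 \<le> n" for n
  proof -
    have "prefix (W m) (W j) \<longleftrightarrow> m \<le> j \<and> t m \<le> t j \<and> t j < upper m" for j
      using prefix_word_imp_le prefix_word_iff by blast
    then have "{v \<in> RT t n. prefix (W m) v} =
        W ` {j. m \<le> j \<and> j < n \<and> t m \<le> t j \<and> t j < upper m}"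
      unfolding RT_input_eq_words[OF that] by auto
    then show ?thesis
      unfolding f_def by (simp add: card_image inj_on_def word_eq_iff)
  qed
  have le: "f n \<le> g n" if "1 \<le> n" for n
    unfolding f[OF that] g_def by (intro card_mono) auto
  have ge: "g n \<le> f n + m" if "1 \<le> n" for n
  proof -
    have "g n \<le> card ({j. m \<le> j \<and> j < n \<and> t m \<le> t j \<and> t j < upper m} \<union> {..<m})"
      unfolding g_def by (intro card_mono) auto
    also have "\<dots> \<le> card {j. m \<le> j \<and> j < n \<and> t m \<le> t j \<and> t j < upper m} + card {..<m}"
      by (rule card_Un_le)
    finally show ?thesis by (simp add: f[OF that])
  qed
  have g_lim: "(\<lambda>n. real (g n) / real n) \<longlonglongrightarrow> upper m - t m"
    unfolding g_def using t_nonneg less_next_label[of m m] next_label_le_1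
    by (intro interval_frequency) auto
  have "(\<lambda>n. real (f n) / real n) \<longlonglongrightarrow> upper m - t m"
  proof (rule tendsto_sandwich)
    show "(\<lambda>n. real (g n) / real n - real m / real n) \<longlonglongrightarrow> upper m - t m"
      using tendsto_diff[OF g_lim lim_const_over_n[of "real m"]] by simp
    show "\<forall>\<^sub>F n in sequentially. real (g n) / real n - real m / real n \<le> real (f n) / real n"
      using eventually_ge_at_top[of 1]
    proof eventually_elim
      case (elim n)
      have "real (g n) - real m \<le> real (f n)" using ge[OF elim] by linarith
      then have "(real (g n) - real m) / real n \<le> real (f n) / real n"
        by (intro divide_right_mono) auto
      then show ?case by (simp add: diff_divide_distrib)
    qed
    show "\<forall>\<^sub>F n in sequentially. real (f n) / real n \<le> real (g n) / real n"
      using eventually_ge_at_top[of 1]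
      by eventually_elim (use le in \<open>auto intro!: divide_right_mono\<close>)
  qed (rule g_lim)
  then show ?thesis by (simp add: f_def)
qed

end

section \<open>Measures on extended words\<close>

lemma cyl_subset: "cyl u \<subseteq> ext_words"
  by (auto simp: cyl_def)

lemma space_ext_words_algebra: "space ext_words_algebra = ext_words"
  and sets_ext_words_algebra: "sets ext_words_algebra = sigma_sets ext_words (cyl ` words)"
  using cyl_subset by (auto simp: ext_words_algebra_def space_measure_of sets_measure_of
      intro!: space_measure_of sets_measure_of)

lemma cyl_in_sets: "u \<in> words \<Longrightarrow> cyl u \<in> sets ext_words_algebra"
  by (simp add: sets_ext_words_algebra)

lemma Word_in_ext_words: "v \<in> words \<Longrightarrow> Word v \<in> ext_words"
  by (simp add: ext_words_def)

lemma prefix_same_cases_cyl: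
  assumes "e \<in> cyl u" "e \<in> cyl v"
  shows "prefix u v \<or> prefix v u"
proof (cases e)
  case (Word w)
  then show ?thesis using assms prefix_same_cases by (auto simp: cyl_def)
next
  case (Seq s)
  have *: "prefix u' v'" if "length u' \<le> length v'" "stake (length u') s = map enat u'"
    "stake (length v') s = map enat v'" for u' v'
  proof -
    have "map enat u' = take (length u') (map enat v')"
      using that by (metis min.absorb1 take_stake)
    then have "map enat u' = map enat (take (length u') v')"
      by (simp add: take_map)
    then have "u' = take (length u') v'"
      by (simp add: inj_map_eq_map inj_def)
    then show ?thesis by (metis take_is_prefix)
  qed
  show ?thesis
    using assms *[of u v] *[of v u] linear[of "length u" "length v"] Seq by (auto simp: cyl_def)
qed

lemma cyl_mono: "prefix u v \<Longrightarrow> cyl v \<subseteq> cyl u"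
proof -
  assume uv: "prefix u v"
  then obtain w where w: "v = u @ w" by (auto simp: prefix_def)
  have "stake (length u) s = map enat u" if "stake (length v) s = map enat v" for s
  proof -
    have "stake (length u) s = take (length u) (stake (length v) s)"
      by (simp add: take_stake w min_def)
    then show ?thesis using that by (simp add: w)
  qed
  moreover have "is_prefix u (Word x)" if "is_prefix v (Word x)" for x
    using uv that prefix_order.trans by auto
  ultimately show ?thesis
    unfolding cyl_def by (auto elim!: is_prefix.elims)
qed

text \<open>
  Two cylinders are nested or disjoint. Hence they form, with the empty set, a generator closed under
  intersections, on which the measurability of a random measure can be checked.
\<close>

lemma Int_stable_cyl: "Int_stable (insert {} (cyl ` words))"
proof (rule Int_stableI)
  fix A B assume AB: "A \<in> insert {} (cyl ` words)" "B \<in> insert {} (cyl ` words)"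
  show "A \<inter> B \<in> insert {} (cyl ` words)"
  proof (cases "A \<inter> B = {}")
    case False
    then obtain u v where uv: "A = cyl u" "B = cyl v" "u \<in> words" "v \<in> words"
      using AB by auto
    then have "prefix u v \<or> prefix v u"
      using False prefix_same_cases_cyl by auto
    then have "A \<inter> B = B \<or> A \<inter> B = A" using cyl_mono uv by blast
    then show ?thesis using AB by auto
  qed simp
qed

lemma sets_ext_words_algebra': "sets ext_words_algebra = sigma_sets ext_words (insert {} (cyl ` words))"
  unfolding sets_ext_words_algebra
  by (intro sigma_sets_eqI) (auto intro: sigma_sets.Empty)

text \<open>
  A prefix-closed chain of words is the set of prefixes of a point: of its longest element if the
  lengths are bounded, and otherwise of the infinite sequence that the words exhaust.
\<close>

lemma exists_extended_word:
  assumes P: "P \<subseteq> words" "[] \<in> P"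
    and closed: "\<And>u v. v \<in> P \<Longrightarrow> prefix u v \<Longrightarrow> u \<in> P"
    and chain: "\<And>u v. u \<in> P \<Longrightarrow> v \<in> P \<Longrightarrow> prefix u v \<or> prefix v u"
  shows "\<exists>e\<in>ext_words. \<forall>u\<in>words. is_prefix u e \<longleftrightarrow> u \<in> P"
proof (cases "\<exists>n. \<forall>v\<in>P. length v \<le> n")
  case True
  then have "finite (length ` P)" by (auto intro: finite_subset[OF _ finite_atMost])
  then have "Max (length ` P) \<in> length ` P" using P by (intro Max_in) auto
  then obtain w where w: "w \<in> P" "length w = Max (length ` P)" by auto
  have "u \<in> P \<longleftrightarrow> prefix u w" for u
  proof
    assume u: "u \<in> P"
    then have "length u \<le> length w" using \<open>finite (length ` P)\<close> w by auto
    then show "prefix u w"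
      using chain[OF u w(1)] by (metis prefix_length_prefix prefix_order.refl)
  qed (use closed w in blast)
  then show ?thesis
    using P w by (intro bexI[of _ "Word w"]) (auto simp: Word_in_ext_words)
next
  case False
  \<comment> \<open>The chain has exactly one word of each length.\<close>
  have ex: "\<exists>v. v \<in> P \<and> length v = n" for n
  proof -
    obtain v where "v \<in> P" "n \<le> length v" using False by (metis nle_le)
    then show ?thesis
      using closed[of v "take n v"] by (intro exI[of _ "take n v"]) (auto simp: take_is_prefix)
  qed
  define f where "f n = (SOME v. v \<in> P \<and> length v = n)" for n
  have f: "f n \<in> P" "length (f n) = n" for n
    using someI_ex[OF ex[of n]] by (auto simp: f_def)
  have f_prefix: "prefix v (f n)" if "v \<in> P" "length v \<le> n" for v n
    using chain[OF that(1) f(1)[of n]] that(2) f(2)[of n] by (metis prefix_length_prefix prefix_order.refl)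
  have f_nth: "f (Suc i) ! i = f n ! i" if "i < n" for i n
    using f_prefix[OF f(1)[of "Suc i"], of n] that f(2)[of "Suc i"]
    by (auto simp: prefix_def nth_append f(2))
  define s where "s = smap (\<lambda>i. enat (f (Suc i) ! i)) (fromN 0)"
  have s: "stake n s = map enat (f n)" for n
    by (rule nth_equalityI) (auto simp: s_def f(2) f_nth)
  have "sset s \<subseteq> enat ` {1..}"
  proof
    fix e assume "e \<in> sset s"
    then obtain i where "e = enat (f (Suc i) ! i)" by (auto simp: s_def stream.set_map)
    moreover have "f (Suc i) ! i \<in> {1..}"
      using P f[of "Suc i"] by (auto simp: words_def in_lists_conv_set)
    ultimately show "e \<in> enat ` {1..}" by blast
  qed
  then have "Seq s \<in> ext_words" by (auto simp: ext_words_def)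
  moreover have "is_prefix u (Seq s) \<longleftrightarrow> u \<in> P" for u
  proof -
    have "is_prefix u (Seq s) \<longleftrightarrow> f (length u) = u"
      by (simp add: s inj_map_eq_map inj_def)
    also have "\<dots> \<longleftrightarrow> u \<in> P"
      using f_prefix[of u "length u"] f[of "length u"] by (auto simp: prefix_def)
    finally show ?thesis .
  qed
  ultimately show ?thesis by blast
qed

text \<open>
  A family of sets indexed by words with the inclusions of a tree is the family of preimages of the
  cylinders under a map: a point \<open>s\<close> goes to the extended word whose prefixes are the \<open>u\<close> with
  \<open>s \<in> I u\<close>. The image measure then has the prescribed masses on the cylinders.
\<close>

lemma (in prob_space) exists_measure_on_ext_words:
  assumes I: "\<And>u. u \<in> words \<Longrightarrow> I u \<in> sets M" and I_Nil: "I [] = space M"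
    and nested: "\<And>u v. v \<in> words \<Longrightarrow> prefix u v \<Longrightarrow> I v \<subseteq> I u"
    and meet: "\<And>u v. u \<in> words \<Longrightarrow> v \<in> words \<Longrightarrow> I u \<inter> I v \<noteq> {} \<Longrightarrow> prefix u v \<or> prefix v u"
  shows "\<exists>\<mu>\<in>space (prob_algebra ext_words_algebra). \<forall>u\<in>words. emeasure \<mu> (cyl u) = emeasure M (I u)"
proof -
  have words_prefix: "u \<in> words" if "v \<in> words" "prefix u v" for u v
    using that by (auto simp: words_def prefix_def)
  have "\<exists>e\<in>ext_words. \<forall>u\<in>words. is_prefix u e \<longleftrightarrow> u \<in> {u \<in> words. s \<in> I u}" if "s \<in> space M" for s
  proof (rule exists_extended_word)
    show "[] \<in> {u \<in> words. s \<in> I u}" using I_Nil that by (simp add: words_def)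
    show "prefix u v \<or> prefix v u" if "u \<in> {u \<in> words. s \<in> I u}" "v \<in> {u \<in> words. s \<in> I u}" for u v
      using meet[of u v] that by blast
  qed (use nested words_prefix in auto)
  then obtain g where g: "\<And>s. s \<in> space M \<Longrightarrow> g s \<in> ext_words"
    "\<And>s u. s \<in> space M \<Longrightarrow> u \<in> words \<Longrightarrow> is_prefix u (g s) \<longleftrightarrow> s \<in> I u"
    by (simp add: Bex_def) metis
  have vimage: "g -` cyl u \<inter> space M = I u" if "u \<in> words" for u
    using that g sets.sets_into_space[OF I[OF that]] by (auto simp: cyl_def)
  have g_meas: "g \<in> measurable M ext_words_algebra"
    unfolding ext_words_algebra_def
  proof (rule measurable_measure_of)
    show "cyl ` words \<subseteq> Pow ext_words" using cyl_subset by blast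
    show "g -` A \<inter> space M \<in> sets M" if "A \<in> cyl ` words" for A
      using that vimage I by auto
  qed (use g in auto)
  show ?thesis
  proof (intro bexI ballI)
    show "distr M ext_words_algebra g \<in> space (prob_algebra ext_words_algebra)"
      using prob_space_distr[OF g_meas] by (simp add: space_prob_algebra)
    show "emeasure (distr M ext_words_algebra g) (cyl u) = emeasure M (I u)" if "u \<in> words" for u
      using vimage[OF that] by (simp add: emeasure_distr g_meas cyl_in_sets that)
  qed
qed

context equidistributed_input
begin

text \<open>
  The intervals of the nodes have the inclusions of the tree, so the uniform distribution on \<open>[0, 1)\<close>
  carries over to the extended words and gives each cylinder the length of its interval.
\<close>

lemma exists_limit_measure:
  "\<exists>\<mu>\<in>space (prob_algebra ext_words_algebra). \<forall>m. measure \<mu> (cyl (W m)) = upper m - t m"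
proof -
  define node where "node u = (THE m. W m = u)" for u
  have node: "W (node u) = u" if "u \<in> words" for u
    using word_appears[OF that] by (auto simp: node_def word_eq_iff)
  have node_W: "node (W m) = m" for m
    by (simp add: node_def word_eq_iff)
  have sub: "subtree_interval m \<subseteq> {0..<1}" for m
    using t_nonneg[of m] next_label_le_1[of m m] by (auto simp: subtree_interval_def)
  define R where "R = restrict_space lborel {0..<1::real}"
  interpret R: prob_space R
    by (intro prob_spaceI) (simp add: R_def emeasure_restrict_space space_restrict_space)
  have [simp]: "space R = {0..<1}" by (simp add: R_def space_restrict_space)
  have "\<exists>\<mu>\<in>space (prob_algebra ext_words_algebra). \<forall>u\<in>words.
      emeasure \<mu> (cyl u) = emeasure R (subtree_interval (node u))"
  proof (rule R.exists_measure_on_ext_words)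
    show "subtree_interval (node u) \<in> sets R" for u
      using sub by (simp add: R_def sets_restrict_space_iff) (simp add: subtree_interval_def)
    show "subtree_interval (node []) = space R"
      using node_W[of 0] by (simp add: word_0 interval_0)
    show "subtree_interval (node v) \<subseteq> subtree_interval (node u)" if "v \<in> words" "prefix u v" for u v
    proof -
      have "u \<in> words" using that by (auto simp: words_def prefix_def)
      then show ?thesis using that by (intro intervals_nested) (simp add: node)
    qed
    show "prefix u v \<or> prefix v u"
      if "u \<in> words" "v \<in> words" "subtree_interval (node u) \<inter> subtree_interval (node v) \<noteq> {}" for u v
      using that intervals_meet_imp_prefix[of "node u" "node v"]
        intervals_meet_imp_prefix[of "node v" "node u"] node linear by (metis Int_emptyI)
  qed
  then obtain \<mu> where \<mu>: "\<mu> \<in> space (prob_algebra ext_words_algebra)"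
    "\<And>u. u \<in> words \<Longrightarrow> emeasure \<mu> (cyl u) = emeasure R (subtree_interval (node u))"
    by blast
  have "measure \<mu> (cyl (W m)) = upper m - t m" for m
  proof -
    have "emeasure \<mu> (cyl (W m)) = emeasure lborel (subtree_interval m)"
      using \<mu>(2)[OF W_in_words] sub by (simp add: node_W R_def emeasure_restrict_space)
    also have "\<dots> = ennreal (upper m - t m)"
      using less_next_label[of m m] by (simp add: subtree_interval_def)
    finally show ?thesis
      using less_next_label[of m m] by (simp add: measure_def)
  qed
  then show ?thesis using \<mu>(1) by blast
qed

end

section \<open>Measurability of RT\<close>

lemma with_zero_measurable:
  fixes \<eta> :: "nat \<Rightarrow> 'a \<Rightarrow> real"
  assumes "\<And>i. 1 \<le> i \<Longrightarrow> \<eta> i \<in> borel_measurable M"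
  shows "(\<lambda>\<omega>. with_zero (\<lambda>i. \<eta> i \<omega>) n) \<in> borel_measurable M"
  using assms[of n] by (cases "n = 0") auto

text \<open>
  RT has to be measurable for every input, including inputs on which labels coincide or \<open>Max\<close> is
  taken over the empty set. All choices in a step depend on data with countably many values: the
  tree, the set of indices over which the maximum is taken, and the set of nodes with a given label.
  For each of these values the step is an explicit measurable function.
\<close>

lemma rt_state_measurable:
  fixes \<eta> :: "nat \<Rightarrow> 'a \<Rightarrow> real"
  assumes \<eta>: "\<And>i. 1 \<le> i \<Longrightarrow> \<eta> i \<in> borel_measurable M"
  shows "(\<lambda>\<omega>. fst (rt_state (\<lambda>i. \<eta> i \<omega>) k)) \<in> M \<rightarrow>\<^sub>M count_space harris_trees \<and>
    (\<forall>w. (\<lambda>\<omega>. snd (rt_state (\<lambda>i. \<eta> i \<omega>) k) w) \<in> borel_measurable M)"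
proof (induction k)
  case 0
  show ?case by (auto simp: singleton_harris)
next
  case (Suc k)
  define x where "x = (\<lambda>\<omega>. fst (rt_state (\<lambda>i. \<eta> i \<omega>) k))"
  define \<phi> where "\<phi> = (\<lambda>\<omega>. snd (rt_state (\<lambda>i. \<eta> i \<omega>) k))"
  define s where "s n = (\<lambda>\<omega>. with_zero (\<lambda>i. \<eta> i \<omega>) n)" for n
  define m where "m = (\<lambda>\<omega>. Max {s j \<omega> | j. j < Suc k \<and> s j \<omega> < s (Suc k) \<omega>})"
  have x[measurable]: "x \<in> M \<rightarrow>\<^sub>M count_space harris_trees"
    and \<phi>[measurable]: "\<And>w. (\<lambda>\<omega>. \<phi> \<omega> w) \<in> borel_measurable M"
    using Suc by (auto simp: x_def \<phi>_def)
  have s[measurable]: "s n \<in> borel_measurable M" for n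
    unfolding s_def by (rule with_zero_measurable[OF \<eta>])
  have m[measurable]: "m \<in> borel_measurable M"
  proof -
    have "(\<lambda>\<omega>. Max ((\<lambda>j. s j \<omega>) ` J)) \<in> borel_measurable M" if "J \<in> Pow {..<Suc k}" for J
      using that finite_subset[of J] by (intro borel_measurable_Max) auto
    moreover have "(\<lambda>\<omega>. {j. j < Suc k \<and> s j \<omega> < s (Suc k) \<omega>}) \<in> M \<rightarrow>\<^sub>M count_space (Pow {..<Suc k})"
    proof (subst measurable_count_space_eq2[OF finite_Pow_iff[THEN iffD2, OF finite_lessThan]], intro conjI ballI)
      fix J assume "J \<in> Pow {..<Suc k}"
      then have "(\<lambda>\<omega>. {j. j < Suc k \<and> s j \<omega> < s (Suc k) \<omega>}) -` {J} \<inter> space M =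
          {\<omega> \<in> space M. \<forall>j\<in>{..<Suc k}. j \<in> J \<longleftrightarrow> s j \<omega> < s (Suc k) \<omega>}"
        by auto
      also have "\<dots> \<in> sets M" by measurable
      finally show "(\<lambda>\<omega>. {j. j < Suc k \<and> s j \<omega> < s (Suc k) \<omega>}) -` {J} \<inter> space M \<in> sets M" .
    qed auto
    ultimately have "(\<lambda>\<omega>. Max ((\<lambda>j. s j \<omega>) ` {j. j < Suc k \<and> s j \<omega> < s (Suc k) \<omega>})) \<in> borel_measurable M"
      by (rule measurable_compose_countable') (auto intro: countable_finite)
    then show ?thesis by (simp add: m_def setcompr_eq_image)
  qed
  define v where "v = (\<lambda>\<omega>. labelled_node (x \<omega>) (\<phi> \<omega>) (m \<omega>))"
  have v[measurable]: "v \<in> M \<rightarrow>\<^sub>M count_space UNIV"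
    unfolding v_def
  proof (rule measurable_compose_countable'[OF _ x countable_harris_trees])
    fix y assume "y \<in> harris_trees"
    then have y: "finite y" by (rule harris_treesD(1))
    have *: "(\<lambda>\<omega>. {w \<in> y. \<phi> \<omega> w = m \<omega>}) \<in> M \<rightarrow>\<^sub>M count_space (Pow y)"
    proof (subst measurable_count_space_eq2[OF finite_Pow_iff[THEN iffD2, OF y]], intro conjI ballI)
      fix z assume "z \<in> Pow y"
      then have "(\<lambda>\<omega>. {w \<in> y. \<phi> \<omega> w = m \<omega>}) -` {z} \<inter> space M =
          {\<omega> \<in> space M. \<forall>w\<in>y. w \<in> z \<longleftrightarrow> \<phi> \<omega> w = m \<omega>}"
        by auto
      also have "\<dots> \<in> sets M" using y by measurable
      finally show "(\<lambda>\<omega>. {w \<in> y. \<phi> \<omega> w = m \<omega>}) -` {z} \<inter> space M \<in> sets M" .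
    qed auto
    have "(\<lambda>\<omega>. labelled_node y (\<phi> \<omega>) (m \<omega>)) =
        (\<lambda>\<omega>. (\<lambda>z. if z \<noteq> {} then SOME w. w \<in> z else []) {w \<in> y. \<phi> \<omega> w = m \<omega>})"
      by (auto simp: labelled_node_def fun_eq_iff)
    then show "(\<lambda>\<omega>. labelled_node y (\<phi> \<omega>) (m \<omega>)) \<in> M \<rightarrow>\<^sub>M count_space UNIV"
      by (simp only:) (rule measurable_compose[OF *], simp)
  qed
  define w where "w = (\<lambda>\<omega>. v \<omega> @ [card {i. v \<omega> @ [i] \<in> x \<omega>} + 1])"
  have w[measurable]: "w \<in> M \<rightarrow>\<^sub>M count_space UNIV"
    unfolding w_def
    by (rule measurable_compose_countable'[OF _ x countable_harris_trees]) measurable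
  have step: "rt_state (\<lambda>i. \<eta> i \<omega>) (Suc k) = (insert (w \<omega>) (x \<omega>), (\<phi> \<omega>)(w \<omega> := s (Suc k) \<omega>))" for \<omega>
    by (cases "rt_state (\<lambda>i. \<eta> i \<omega>) k") (simp add: Let_def w_def v_def m_def s_def x_def \<phi>_def)
  have "(\<lambda>\<omega>. insert (w \<omega>) (x \<omega>)) \<in> M \<rightarrow>\<^sub>M count_space harris_trees"
  proof (subst measurable_count_space_eq_countable[OF countable_harris_trees], intro conjI ballI)
    show "(\<lambda>\<omega>. insert (w \<omega>) (x \<omega>)) \<in> space M \<rightarrow> harris_trees"
    proof
      show "insert (w \<omega>) (x \<omega>) \<in> harris_trees" for \<omega>
        using rt_state_harris[of "\<lambda>i. \<eta> i \<omega>" "Suc k"] unfolding step by simp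
    qed
    have "(\<lambda>\<omega>. insert (w \<omega>) (x \<omega>)) \<in> M \<rightarrow>\<^sub>M count_space UNIV"
      by (rule measurable_compose_countable'[OF _ x countable_harris_trees])
        (rule measurable_compose[OF w], simp)
    then show "(\<lambda>\<omega>. insert (w \<omega>) (x \<omega>)) -` {y} \<inter> space M \<in> sets M" for y
      by (rule measurable_sets) simp
  qed
  moreover have "(\<lambda>\<omega>. ((\<phi> \<omega>)(w \<omega> := s (Suc k) \<omega>)) u) \<in> borel_measurable M" for u
    unfolding fun_upd_def by measurable
  ultimately show ?case unfolding step by simp
qed

lemma RT_measurable:
  fixes \<eta> :: "nat \<Rightarrow> 'a \<Rightarrow> real"
  assumes "\<And>i. 1 \<le> i \<Longrightarrow> \<eta> i \<in> borel_measurable M"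
  shows "(\<lambda>\<omega>. RT (\<lambda>i. \<eta> i \<omega>) n) \<in> M \<rightarrow>\<^sub>M count_space harris_trees"
  using rt_state_measurable[OF assms] by (simp add: RT_def)

lemma predecessor_measurable:
  assumes [measurable]: "\<And>i. s i \<in> borel_measurable M"
  shows "(\<lambda>\<omega>. predecessor (\<lambda>i. s i \<omega>) n) \<in> M \<rightarrow>\<^sub>M count_space UNIV"
proof -
  have [measurable]: "Measurable.pred M (\<lambda>\<omega>. is_predecessor (\<lambda>i. s i \<omega>) n j)" for j
    unfolding is_predecessor_def by measurable
  show ?thesis unfolding predecessor_def by measurable
qed

section \<open>The order of an exchangeable sample\<close>

text \<open>
  Prescribing the first \<open>n\<close> predecessors amounts to prescribing the order of \<open>t\<^sub>1, \<dots>, t\<^sub>n\<close>: the list of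
  indices in increasing order of their labels arises by inserting each index directly after its
  predecessor.
\<close>

lemma insertion_order_list:
  assumes "\<And>i. 1 \<le> i \<Longrightarrow> i \<le> n \<Longrightarrow> q i < i"
  shows "\<exists>l. distinct l \<and> set l = {1..n} \<and> (\<forall>t. distinct_input t \<longrightarrow>
    ((\<forall>i\<in>{1..n}. predecessor t i = q i) \<longleftrightarrow> sorted_wrt (<) (map t (0 # l))))"
  using assms
proof (induction n)
  case 0
  then show ?case by (intro exI[of _ "[]"]) simp
next
  case (Suc n)
  then obtain l where l: "distinct l" "set l = {1..n}"
    and eq: "\<And>t. distinct_input t \<Longrightarrow>
      (\<forall>i\<in>{1..n}. predecessor t i = q i) \<longleftrightarrow> sorted_wrt (<) (map t (0 # l))"
    by auto
  define j where "j = q (Suc n)"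
  have "j < Suc n" using Suc.prems[of "Suc n"] by (simp add: j_def)
  then have "j \<in> set (0 # l)" using l(2) by (cases j) auto
  then obtain xs ys where split: "0 # l = xs @ j # ys" by (metis split_list)
  define L where "L = xs @ [j, Suc n] @ ys"
  have "set (0 # l) = {..n}" using l(2) by auto
  then have set_split: "set xs \<union> {j} \<union> set ys = {..n}"
    unfolding split by simp
  obtain l' where l': "L = 0 # l'"
    using split by (cases xs) (auto simp: L_def)
  have "distinct (0 # l)" using l by simp
  then have "distinct L" unfolding split L_def using set_split by auto
  then have "distinct l'" by (simp add: l')
  moreover have "set l' = {1..Suc n}"
  proof -
    have "set L = insert (Suc n) (set xs \<union> {j} \<union> set ys)" by (auto simp: L_def)
    then have "set L = {..Suc n}" using set_split by (simp add: atMost_Suc)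
    moreover have "set l' = set L - {0}" using \<open>distinct L\<close> by (simp add: l')
    moreover have "{..Suc n} - {0} = {1..Suc n}" by auto
    ultimately show ?thesis by simp
  qed
  moreover have "(\<forall>i\<in>{1..Suc n}. predecessor t i = q i) \<longleftrightarrow> sorted_wrt (<) (map t L)"
    if "distinct_input t" for t
  proof -
    interpret distinct_input t by fact
    have "(\<forall>i\<in>{1..Suc n}. predecessor t i = q i) \<longleftrightarrow>
        (\<forall>i\<in>{1..n}. predecessor t i = q i) \<and> predecessor t (Suc n) = j"
      by (auto simp: j_def le_Suc_eq)
    also have "\<dots> \<longleftrightarrow> sorted_wrt (<) (map t (xs @ j # ys)) \<and> predecessor t (Suc n) = j"
      unfolding eq[OF that] split ..
    also have "\<dots> \<longleftrightarrow> sorted_wrt (<) (map t L)"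
    proof
      assume A: "sorted_wrt (<) (map t (xs @ j # ys)) \<and> predecessor t (Suc n) = j"
      then have j: "t j < t (Suc n)" using pre_less[of "Suc n"] by auto
      moreover have "t (Suc n) < t y" if "y \<in> set ys" for y
      proof -
        have y: "y \<le> n" "t j < t y" using A that set_split by (auto simp: sorted_wrt_append)
        then have "\<not> t y < t (Suc n)" using pre_maximal[of y "Suc n"] A by auto
        moreover have "t y \<noteq> t (Suc n)" using t_inj y by auto
        ultimately show ?thesis by simp
      qed
      moreover have "t x < t (Suc n)" if "x \<in> set xs" for x
        using A that j by (force simp: sorted_wrt_append)
      ultimately show "sorted_wrt (<) (map t L)"
        using A by (auto simp: L_def sorted_wrt_append)
    next
      assume A: "sorted_wrt (<) (map t L)"
      have "pre (Suc n) = j"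
      proof (rule pre_eqI)
        show "j < Suc n" by fact
        show "t j < t (Suc n)" using A by (simp add: L_def sorted_wrt_append)
        fix i assume i: "i < Suc n" "t i < t (Suc n)"
        then have "i \<in> set xs \<union> {j} \<union> set ys" unfolding set_split by simp
        moreover have "i \<notin> set ys" using A i(2) by (auto simp: L_def sorted_wrt_append)
        ultimately have "i \<in> set xs \<or> i = j" by blast
        then show "t i \<le> t j" using A by (auto simp: L_def sorted_wrt_append)
      qed
      then show "sorted_wrt (<) (map t (xs @ j # ys)) \<and> predecessor t (Suc n) = j"
        using A by (simp add: L_def sorted_wrt_append)
    qed
    finally show ?thesis .
  qed
  ultimately show ?case by (intro exI[of _ l']) (simp add: l')
qed

text \<open>
  Exchangeability: the coordinates listed by \<open>l\<close> have the same joint law as the first \<open>length l\<close>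
  coordinates, so the probability that they are increasing depends on the length of \<open>l\<close> alone.
\<close>

lemma (in prob_space) order_event_prob:
  fixes \<eta> :: "nat \<Rightarrow> 'a \<Rightarrow> real"
  assumes indep: "indep_vars (\<lambda>_. borel) \<eta> I" and I: "I \<noteq> {}"
    and ident: "\<And>i. i \<in> I \<Longrightarrow> distr M borel (\<eta> i) = D"
    and l: "distinct l" "set l \<subseteq> I"
  shows "{\<omega> \<in> space M. sorted_wrt (<) (map (\<lambda>i. \<eta> i \<omega>) l)} \<in> events"
    and "prob {\<omega> \<in> space M. sorted_wrt (<) (map (\<lambda>i. \<eta> i \<omega>) l)} =
      measure (PiM {..<length l} (\<lambda>_. D))
        {x \<in> space (PiM {..<length l} (\<lambda>_. D)). \<forall>i<length l. \<forall>j<length l. i < j \<longrightarrow> x i < x j}"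
proof -
  define n where "n = length l"
  define X where "X = (\<lambda>\<omega>. \<lambda>k\<in>{..<n}. \<eta> (l ! k) \<omega>)"
  define A where "A = {x \<in> space (PiM {..<n} (\<lambda>_. D)). \<forall>i<n. \<forall>j<n. i < j \<longrightarrow> x i < x j}"
  have rv[measurable]: "\<eta> i \<in> borel_measurable M" if "i \<in> I" for i
    using indep that by (auto simp: indep_vars_def)
  have nth: "l ! k \<in> I" if "k < n" for k
    using l that by (auto simp: n_def)
  obtain i0 where "i0 \<in> I" using I by auto
  have D: "prob_space D" "sets D = sets borel" "space D = UNIV"
    using ident[OF \<open>i0 \<in> I\<close>] rv[OF \<open>i0 \<in> I\<close>] by (auto intro!: prob_space_distr)
  have sets_D: "sets (PiM K (\<lambda>_. D)) = sets (PiM K (\<lambda>_. borel))" for K :: "nat set"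
    by (rule sets_PiM_cong) (simp_all add: D)
  have all: "distr M (PiM I (\<lambda>_. borel)) (\<lambda>\<omega>. \<lambda>i\<in>I. \<eta> i \<omega>) = PiM I (\<lambda>_. D)"
    using indep_vars_iff_distr_eq_PiM'[where M' = "\<lambda>_. borel" and X = \<eta> and I = I, OF I rv] indep ident
    by (simp cong: PiM_cong)
  have X[measurable]: "X \<in> M \<rightarrow>\<^sub>M PiM {..<n} (\<lambda>_. D)"
    unfolding X_def using nth by (intro measurable_restrict) (simp add: D(2) cong: measurable_cong_sets)
  have law: "distr M (PiM {..<n} (\<lambda>_. D)) X = PiM {..<n} (\<lambda>_. D)"
  proof -
    have "PiM {..<n} (\<lambda>_. D) = distr (PiM I (\<lambda>_. D)) (PiM {..<n} (\<lambda>_. D)) (\<lambda>\<omega>. \<lambda>k\<in>{..<n}. \<omega> (l ! k))"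
      using distr_PiM_reindex[of I "\<lambda>_. D" "\<lambda>k. l ! k" "{..<n}"] D(1) l(1) nth
      by (simp add: inj_on_def nth_eq_iff_index_eq n_def Pi_iff)
    also have "\<dots> = distr M (PiM {..<n} (\<lambda>_. D)) ((\<lambda>\<omega>. \<lambda>k\<in>{..<n}. \<omega> (l ! k)) \<circ> (\<lambda>\<omega>. \<lambda>i\<in>I. \<eta> i \<omega>))"
      unfolding all[symmetric]
    proof (rule distr_distr)
      show "(\<lambda>\<omega>. \<lambda>k\<in>{..<n}. \<omega> (l ! k)) \<in> PiM I (\<lambda>_. borel) \<rightarrow>\<^sub>M PiM {..<n} (\<lambda>_. D)"
        using nth by (intro measurable_restrict) (simp add: D(2) cong: measurable_cong_sets)
      show "(\<lambda>\<omega>. \<lambda>i\<in>I. \<eta> i \<omega>) \<in> M \<rightarrow>\<^sub>M PiM I (\<lambda>_. borel)"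
        by measurable
    qed
    also have "(\<lambda>\<omega>. \<lambda>k\<in>{..<n}. \<omega> (l ! k)) \<circ> (\<lambda>\<omega>. \<lambda>i\<in>I. \<eta> i \<omega>) = X"
      using nth by (auto simp: X_def fun_eq_iff restrict_def)
    finally show ?thesis by simp
  qed
  have A: "A \<in> sets (PiM {..<n} (\<lambda>_. D))"
  proof -
    have [measurable]: "(\<lambda>x. x i) \<in> borel_measurable (PiM {..<n} (\<lambda>_. D))" if "i < n" for i
      using measurable_component_singleton[of i "{..<n}" "\<lambda>_. D"] that
      by (simp add: D(2) cong: measurable_cong_sets)
    have "A = {x \<in> space (PiM {..<n} (\<lambda>_. D)). \<forall>i\<in>{..<n}. \<forall>j\<in>{..<n}. i < j \<longrightarrow> x i < x j}"
      by (auto simp: A_def)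
    also have "\<dots> \<in> sets (PiM {..<n} (\<lambda>_. D))"
      by (intro sets.sets_Collect_finite_All sets.sets_Collect_imp borel_measurable_less) auto
    finally show ?thesis .
  qed
  have vimage: "X -` A \<inter> space M = {\<omega> \<in> space M. sorted_wrt (<) (map (\<lambda>i. \<eta> i \<omega>) l)}"
    using measurable_space[OF X] by (auto simp: A_def X_def sorted_wrt_iff_nth_less n_def)
  show "{\<omega> \<in> space M. sorted_wrt (<) (map (\<lambda>i. \<eta> i \<omega>) l)} \<in> events"
    unfolding vimage[symmetric] by (rule measurable_sets[OF X A])
  have "prob (X -` A \<inter> space M) = measure (PiM {..<n} (\<lambda>_. D)) A"
    using measure_distr[OF X A] by (simp add: law)
  then show "prob {\<omega> \<in> space M. sorted_wrt (<) (map (\<lambda>i. \<eta> i \<omega>) l)} =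
      measure (PiM {..<length l} (\<lambda>_. D))
        {x \<in> space (PiM {..<length l} (\<lambda>_. D)). \<forall>i<length l. \<forall>j<length l. i < j \<longrightarrow> x i < x j}"
    unfolding vimage unfolding A_def n_def .
qed

lemma count_space_event:
  assumes "f \<in> M \<rightarrow>\<^sub>M count_space A"
  shows "{\<omega> \<in> space M. f \<omega> = c} \<in> sets M"
proof -
  have "f -` ({c} \<inter> A) \<inter> space M \<in> sets M"
    by (rule measurable_sets[OF assms]) simp
  also have "f -` ({c} \<inter> A) \<inter> space M = {\<omega> \<in> space M. f \<omega> = c}"
    using measurable_space[OF assms] by auto
  finally show ?thesis .
qed

text \<open>
  There are \<open>n!\<close> possible values for the first \<open>n\<close> attachments. Each of them is an order event up to
  a null set, all order events are equally likely, and together they fill the space.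
\<close>

lemma (in prob_space) predecessor_uniform:
  fixes \<eta> :: "nat \<Rightarrow> 'a \<Rightarrow> real"
  assumes indep: "indep_vars (\<lambda>_. borel) \<eta> {1..}"
    and ident: "\<And>i. 1 \<le> i \<Longrightarrow> distr M borel (\<eta> i) = D"
    and dist: "AE \<omega> in M. distinct_input (with_zero (\<lambda>i. \<eta> i \<omega>))"
    and V: "\<And>i. 1 \<le> i \<Longrightarrow> V i \<in> M \<rightarrow>\<^sub>M count_space {1..i}"
    and V_def: "\<And>i \<omega>. 1 \<le> i \<Longrightarrow> V i \<omega> = Suc (predecessor (with_zero (\<lambda>i. \<eta> i \<omega>)) i)"
    and k: "k \<in> (\<Pi>\<^sub>E i\<in>{1..n}. {1..i})"
  shows "prob {\<omega> \<in> space M. \<forall>i\<in>{1..n}. V i \<omega> = k i} = 1 / fact n"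
proof -
  define E where "E k = {\<omega> \<in> space M. \<forall>i\<in>{1..n}. V i \<omega> = k i}" for k
  define p where "p = measure (PiM {..<n} (\<lambda>_. D))
        {x \<in> space (PiM {..<n} (\<lambda>_. D)). \<forall>i<n. \<forall>j<n. i < j \<longrightarrow> x i < x j}"
  let ?K = "\<Pi>\<^sub>E i\<in>{1..n}. {1..i}"
  have E: "E k \<in> events" for k
    unfolding E_def
    by (intro sets.sets_Collect_finite_All count_space_event[OF V]) auto
  have prob_E: "prob (E k) = p" if "k \<in> ?K" for k
  proof -
    have "k i - 1 < i" if "1 \<le> i" "i \<le> n" for i
      using PiE_mem[OF \<open>k \<in> ?K\<close>, of i] that by auto
    from insertion_order_list[of n "\<lambda>i. k i - 1", OF this] obtain l
      where l: "distinct l" "set l = {1..n}"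
      and eq: "\<And>t. distinct_input t \<Longrightarrow>
        (\<forall>i\<in>{1..n}. predecessor t i = k i - 1) \<longleftrightarrow> sorted_wrt (<) (map t (0 # l))"
      by auto
    have len: "length l = n"
      using distinct_card[OF l(1)] l(2) by simp
    note order = order_event_prob[OF indep _ ident l(1)]
    have "prob (E k) = prob {\<omega> \<in> space M. sorted_wrt (<) (map (\<lambda>i. \<eta> i \<omega>) l)}"
    proof (rule finite_measure_eq_AE)
      show "AE \<omega> in M. \<omega> \<in> E k \<longleftrightarrow> \<omega> \<in> {\<omega> \<in> space M. sorted_wrt (<) (map (\<lambda>i. \<eta> i \<omega>) l)}"
        using dist
      proof (eventually_elim, goal_cases)
        case (1 \<omega>)
        define t where "t = with_zero (\<lambda>i. \<eta> i \<omega>)"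
        interpret distinct_input t using 1 by (simp add: t_def)
        have "\<omega> \<in> E k \<longleftrightarrow> \<omega> \<in> space M \<and> (\<forall>i\<in>{1..n}. predecessor t i = k i - 1)"
          using PiE_mem[OF \<open>k \<in> ?K\<close>] by (force simp: E_def V_def t_def)
        also have "\<dots> \<longleftrightarrow> \<omega> \<in> space M \<and> sorted_wrt (<) (map t (0 # l))"
          by (simp only: eq[OF distinct_input_axioms])
        also have "sorted_wrt (<) (map t (0 # l)) \<longleftrightarrow> sorted_wrt (<) (map t l)"
          using l(2) t_0 t_pos by auto
        also have "map t l = map (\<lambda>i. \<eta> i \<omega>) l"
          using l(2) by (auto simp: t_def)
        finally show ?case by simp
      qed
      show "{\<omega> \<in> space M. sorted_wrt (<) (map (\<lambda>i. \<eta> i \<omega>) l)} \<in> events"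
        by (rule order(1)) (auto simp: l(2))
    qed (rule E)
    also have "\<dots> = p"
      unfolding p_def len[symmetric] by (rule order(2)) (auto simp: l(2))
    finally show ?thesis .
  qed
  have "(\<Union>k\<in>?K. E k) = space M"
  proof
    show "space M \<subseteq> (\<Union>k\<in>?K. E k)"
    proof
      fix \<omega> assume \<omega>: "\<omega> \<in> space M"
      then have "(\<lambda>i\<in>{1..n}. V i \<omega>) \<in> ?K"
        using measurable_space[OF V] by (auto simp: PiE_iff)
      moreover have "\<omega> \<in> E (\<lambda>i\<in>{1..n}. V i \<omega>)" using \<omega> by (simp add: E_def)
      ultimately show "\<omega> \<in> (\<Union>k\<in>?K. E k)" by blast
    qed
  qed (auto simp: E_def)
  then have "1 = prob (\<Union>k\<in>?K. E k)" by (simp add: prob_space)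
  also have "\<dots> = (\<Sum>k\<in>?K. prob (E k))"
  proof (rule finite_measure_finite_Union)
    show "disjoint_family_on E ?K"
      unfolding disjoint_family_on_def
    proof (intro ballI impI equals0I)
      fix k k' \<omega> assume "k \<in> ?K" "k' \<in> ?K" "k \<noteq> k'" "\<omega> \<in> E k \<inter> E k'"
      then show False using PiE_ext[of k "{1..n}" _ k'] by (auto simp: E_def)
    qed
  qed (use E in \<open>auto intro: finite_PiE\<close>)
  also have "\<dots> = real (card ?K) * p" by (simp add: prob_E)
  also have "card ?K = fact n" by (simp add: card_PiE fact_prod)
  finally have "p = 1 / fact n" by (simp add: field_simps)
  then show ?thesis using prob_E[OF k] by (simp add: E_def)
qed

text \<open>
  The uniform weights \<open>1 / n!\<close> on the first \<open>n\<close> coordinates are the finite-dimensional laws of an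
  independent sequence with uniform coordinates, and these determine the law.
\<close>

lemma (in prob_space) uniform_sequence_law:
  assumes V: "\<And>i. 1 \<le> i \<Longrightarrow> V i \<in> M \<rightarrow>\<^sub>M count_space {1..i}"
    and unif: "\<And>n k. k \<in> (\<Pi>\<^sub>E i\<in>{1..n}. {1..i}) \<Longrightarrow>
      prob {\<omega> \<in> space M. \<forall>i\<in>{1..n}. V i \<omega> = k i} = 1 / fact n"
  shows "distr M (PiM {1..} (\<lambda>i. count_space {1..i})) (\<lambda>\<omega>. \<lambda>i\<in>{1..}. V i \<omega>) =
    PiM {1..} (\<lambda>i. uniform_count_measure {1..i})"
proof (rule measure_eqI_PiM_infinite)
  let ?C = "PiM {1..} (\<lambda>i. count_space {1..i})"
  let ?X = "\<lambda>\<omega>. \<lambda>i\<in>{1..}. V i \<omega>"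
  have X: "?X \<in> M \<rightarrow>\<^sub>M ?C" by (intro measurable_restrict V) simp
  show sets: "sets (distr M ?C ?X) = sets (PiM {1..} (\<lambda>i. uniform_count_measure {1..i}))"
    by (simp, rule sets_PiM_cong) (simp_all add: sets_uniform_count_measure_count_space)
  show "finite_measure (distr M ?C ?X)"
    using prob_space_distr[OF X] by (simp add: prob_space_def)
  fix A and J :: "nat set"
  assume J: "finite J" "J \<subseteq> {1..}" and A: "\<And>i. i \<in> J \<Longrightarrow> A i \<in> sets (uniform_count_measure {1..i})"
  have A': "A i \<subseteq> {1..i}" if "i \<in> J" for i
    using A[OF that] by (simp add: sets_uniform_count_measure_count_space)
  \<comment> \<open>Fill up the finite index set to an initial segment, with full ranges at the new places.\<close>
  define n where "n = Max (insert 0 J)"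
  have Jn: "J \<subseteq> {1..n}" using J by (auto simp: n_def)
  define B where "B i = (if i \<in> J then A i else {1..i})" for i
  have B: "B i \<subseteq> {1..i}" for i using A' by (auto simp: B_def)
  define E where "E k = {\<omega> \<in> space M. \<forall>i\<in>{1..n}. V i \<omega> = k i}" for k
  let ?emb = "prod_emb {1..} (\<lambda>i. uniform_count_measure {1..i}) J (Pi\<^sub>E J A)"
  have emb_sets: "?emb \<in> sets ?C"
    using sets_PiM_I[OF J(1) J(2), of A "\<lambda>i. uniform_count_measure {1..i}"] A sets by simp
  have V_in: "V i \<omega> \<in> {1..i}" if "1 \<le> i" "\<omega> \<in> space M" for i \<omega>
    using measurable_space[OF V[OF that(1)] that(2)] by simp
  have E: "E k \<in> events" for k
    unfolding E_def
    by (intro sets.sets_Collect_finite_All count_space_event[OF V]) auto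
  have J_pos: "Suc 0 \<le> i" if "i \<in> J" for i using J(2) that by auto
  have "?X -` ?emb \<inter> space M = {\<omega> \<in> space M. \<forall>i\<in>J. V i \<omega> \<in> A i}"
    using V_in by (auto simp: prod_emb_def PiE_iff space_uniform_count_measure J_pos)
  also have "\<dots> = (\<Union>k\<in>Pi\<^sub>E {1..n} B. E k)"
  proof (intro set_eqI iffI)
    fix \<omega> assume \<omega>: "\<omega> \<in> {\<omega> \<in> space M. \<forall>i\<in>J. V i \<omega> \<in> A i}"
    then have "(\<lambda>i\<in>{1..n}. V i \<omega>) \<in> Pi\<^sub>E {1..n} B"
      using V_in by (auto simp: B_def)
    moreover have "\<omega> \<in> E (\<lambda>i\<in>{1..n}. V i \<omega>)" using \<omega> by (simp add: E_def)
    ultimately show "\<omega> \<in> (\<Union>k\<in>Pi\<^sub>E {1..n} B. E k)" by blast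
  next
    fix \<omega> assume "\<omega> \<in> (\<Union>k\<in>Pi\<^sub>E {1..n} B. E k)"
    then obtain k where k: "k \<in> Pi\<^sub>E {1..n} B" "\<omega> \<in> E k" by blast
    have "V i \<omega> \<in> A i" if "i \<in> J" for i
    proof -
      have "i \<in> {1..n}" using that Jn by blast
      then have "V i \<omega> = k i" "k i \<in> B i" using k by (auto simp: E_def PiE_iff)
      then show ?thesis using that by (simp add: B_def)
    qed
    then show "\<omega> \<in> {\<omega> \<in> space M. \<forall>i\<in>J. V i \<omega> \<in> A i}" using k(2) by (auto simp: E_def)
  qed
  finally have vimage: "?X -` ?emb \<inter> space M = (\<Union>k\<in>Pi\<^sub>E {1..n} B. E k)" .
  have finB: "finite (B i)" for i using B finite_subset by blast
  have "prob (\<Union>k\<in>Pi\<^sub>E {1..n} B. E k) = (\<Sum>k\<in>Pi\<^sub>E {1..n} B. prob (E k))"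
  proof (rule finite_measure_finite_Union)
    show "disjoint_family_on E (Pi\<^sub>E {1..n} B)"
      unfolding disjoint_family_on_def
    proof (intro ballI impI equals0I)
      fix k k' \<omega> assume "k \<in> Pi\<^sub>E {1..n} B" "k' \<in> Pi\<^sub>E {1..n} B" "k \<noteq> k'" "\<omega> \<in> E k \<inter> E k'"
      then show False using PiE_ext[of k "{1..n}" B k'] by (auto simp: E_def)
    qed
  qed (use E finB in \<open>auto intro: finite_PiE\<close>)
  also have "\<dots> = (\<Sum>k\<in>Pi\<^sub>E {1..n} B. 1 / fact n)"
  proof (rule sum.cong)
    fix k assume "k \<in> Pi\<^sub>E {1..n} B"
    then have "k \<in> (\<Pi>\<^sub>E i\<in>{1..n}. {1..i})" using B by (blast intro: PiE_mono[THEN subsetD])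
    then show "prob (E k) = 1 / fact n" unfolding E_def by (rule unif)
  qed simp
  also have "\<dots> = (\<Prod>i\<in>{1..n}. real (card (B i)) / real i)"
    by (simp add: card_PiE fact_prod prod_dividef)
  also have "\<dots> = (\<Prod>i\<in>J. real (card (B i)) / real i)"
    using Jn by (intro prod.mono_neutral_right) (auto simp: B_def)
  also have "\<dots> = (\<Prod>i\<in>J. real (card (A i)) / real i)"
    by (intro prod.cong) (auto simp: B_def)
  finally have prob_eq: "prob (?X -` ?emb \<inter> space M) = (\<Prod>i\<in>J. real (card (A i)) / real i)"
    by (simp only: vimage)
  have "emeasure (distr M ?C ?X) ?emb = ennreal (\<Prod>i\<in>J. real (card (A i)) / real i)"
    unfolding emeasure_distr[OF X emb_sets] emeasure_eq_measure prob_eq ..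
  also have "\<dots> = (\<Prod>i\<in>J. ennreal (real (card (A i)) / real i))"
    by (simp add: prod_ennreal)
  also have "\<dots> = (\<Prod>i\<in>J. emeasure (uniform_count_measure {1..i}) (A i))"
    using A' J by (intro prod.cong) (auto simp: emeasure_uniform_count_measure)
  also have "\<dots> = emeasure (PiM {1..} (\<lambda>i. uniform_count_measure {1..i})) ?emb"
    using J A by (intro emeasure_PiM_emb[symmetric] prob_space_uniform_count_measure) auto
  finally show "emeasure (distr M ?C ?X) ?emb =
    emeasure (PiM {1..} (\<lambda>i. uniform_count_measure {1..i})) ?emb" .
qed simp

section \<open>Almost sure properties of uniform input\<close>

lemma RT_with_zero: "RT (with_zero s) n = RT s n"
proof -
  have "rt_state (with_zero s) k = rt_state s k" for k
    by (induction k) (simp_all only: rt_state.simps fun_upd_upd)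
  then show ?thesis by (simp add: RT_def)
qed

locale uniform_input = prob_space +
  fixes \<eta> :: "nat \<Rightarrow> 'a \<Rightarrow> real"
  assumes indep: "indep_vars (\<lambda>_. borel) \<eta> {1..}"
    and uniform: "1 \<le> i \<Longrightarrow> distr M borel (\<eta> i) = uniform_measure lborel {0<..<1}"
begin

lemma \<eta>_measurable: "1 \<le> i \<Longrightarrow> \<eta> i \<in> borel_measurable M"
  using indep by (auto simp: indep_vars_def)

lemma AE_in_unit_interval: "1 \<le> i \<Longrightarrow> AE \<omega> in M. 0 < \<eta> i \<omega> \<and> \<eta> i \<omega> < 1"
proof -
  assume i: "1 \<le> i"
  have "AE x in distr M borel (\<eta> i). x \<in> {0<..<1}"
    unfolding uniform[OF i] by (rule AE_uniform_measureI) auto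
  then show ?thesis
    by (subst (asm) AE_distr_iff) (auto simp: \<eta>_measurable[OF i])
qed

text \<open>
  By independence the pair has a product law with atomless factors, for which the diagonal is null.
\<close>

lemma AE_distinct:
  assumes "1 \<le> i" "1 \<le> j" "i \<noteq> j"
  shows "AE \<omega> in M. \<eta> i \<omega> \<noteq> \<eta> j \<omega>"
proof -
  let ?D = "uniform_measure lborel {0<..<1::real}"
  interpret D: prob_space ?D by (rule prob_space_uniform_measure) auto
  interpret DD: pair_prob_space ?D ?D ..
  have "indep_var (PiM {i} (\<lambda>_. borel)) (\<lambda>\<omega>. restrict (\<lambda>i. \<eta> i \<omega>) {i})
      (PiM {j} (\<lambda>_. borel)) (\<lambda>\<omega>. restrict (\<lambda>i. \<eta> i \<omega>) {j})"
    using assms by (intro indep_var_restrict[OF indep]) auto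
  from indep_var_compose[OF this, of "\<lambda>x. x i" borel "\<lambda>x. x j" borel]
  have "indep_var borel (\<eta> i) borel (\<eta> j)"
    by (simp add: comp_def)
  then have law: "?D \<Otimes>\<^sub>M ?D = distr M (borel \<Otimes>\<^sub>M borel) (\<lambda>\<omega>. (\<eta> i \<omega>, \<eta> j \<omega>))"
    using uniform assms by (simp add: indep_var_distribution_eq)
  have meas: "{x \<in> space (borel \<Otimes>\<^sub>M borel). fst x \<noteq> (snd x :: real)} \<in> sets (borel \<Otimes>\<^sub>M borel)"
    by measurable
  have sets_DD: "sets (?D \<Otimes>\<^sub>M ?D) = sets (borel \<Otimes>\<^sub>M borel)"
    by (rule sets_pair_measure_cong) simp_all
  have "AE x in ?D \<Otimes>\<^sub>M ?D. fst x \<noteq> snd x"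
  proof (rule DD.AE_pair_measure)
    show "{x \<in> space (?D \<Otimes>\<^sub>M ?D). fst x \<noteq> snd x} \<in> sets (?D \<Otimes>\<^sub>M ?D)"
      using meas by (simp add: sets_DD sets_eq_imp_space_eq[OF sets_DD])
    have "AE y in ?D. x \<noteq> y" for x
      by (rule AE_uniform_measureI) (auto intro: AE_mp[OF AE_lborel_singleton[of x]])
    then show "AE x in ?D. AE y in ?D. fst (x, y) \<noteq> snd (x, y)" by simp
  qed
  then show ?thesis
    unfolding law using meas
    by (subst (asm) AE_distr_iff) (auto intro!: measurable_Pair \<eta>_measurable assms(1,2))
qed

lemma AE_unit_input: "AE \<omega> in M. unit_input (with_zero (\<lambda>i. \<eta> i \<omega>))"
proof -
  have "AE \<omega> in M. \<forall>i\<in>{1..}. 0 < \<eta> i \<omega> \<and> \<eta> i \<omega> < 1"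
    using AE_in_unit_interval by (subst AE_ball_countable) auto
  moreover have "AE \<omega> in M. \<forall>i\<in>{1..}. \<forall>j\<in>{1..} - {i}. \<eta> i \<omega> \<noteq> \<eta> j \<omega>"
    using AE_distinct by (simp add: AE_ball_countable)
  ultimately show ?thesis
  proof eventually_elim
    case (elim \<omega>)
    show ?case
    proof unfold_locales
      fix m n :: nat
      have pos: "0 < \<eta> i \<omega>" if "i \<noteq> 0" for i using elim(1) that by simp
      have "\<eta> m \<omega> \<noteq> \<eta> n \<omega>" if "m \<noteq> 0" "n \<noteq> 0" "m \<noteq> n"
        using elim(2) that by simp
      then show "(with_zero (\<lambda>i. \<eta> i \<omega>) m = with_zero (\<lambda>i. \<eta> i \<omega>) n) = (m = n)"
        using pos[of m] pos[of n] by auto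
    qed (use elim in auto)
  qed
qed

text \<open>
  The strong law for indicators: the tail bounds of Hoeffding are summable in \<open>n\<close>, so by
  Borel--Cantelli only finitely many frequencies deviate from \<open>r\<close> by a given amount.
\<close>

lemma AE_frequency:
  assumes r: "0 \<le> r" "r \<le> 1"
  shows "AE \<omega> in M. (\<lambda>n. (\<Sum>i\<in>{1..n}. indicator {..<r} (\<eta> i \<omega>)) / real n) \<longlonglongrightarrow> r"
proof -
  define X where "X i \<omega> = (indicator {..<r} (\<eta> i \<omega>) :: real)" for i \<omega>
  have [measurable]: "X i \<in> borel_measurable M" if "1 \<le> i" for i
    unfolding X_def using \<eta>_measurable[OF that] by measurable
  have X_indep: "indep_vars (\<lambda>_. borel) X {1..}"
    unfolding X_def by (rule indep_vars_compose2[OF indep]) measurable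
  have expect: "expectation (X i) = r" if i: "1 \<le> i" for i
  proof -
    have "expectation (X i) = (\<integral>x. indicator {..<r} x \<partial>distr M borel (\<eta> i))"
      unfolding X_def by (rule integral_distr[symmetric]) (auto simp: \<eta>_measurable[OF i])
    also have "\<dots> = measure (uniform_measure lborel {0<..<1}) {..<r}"
      unfolding uniform[OF i] by simp
    also have "\<dots> = measure lborel ({0<..<1} \<inter> {..<r})"
      by (subst measure_uniform_measure) auto
    also have "{0<..<1} \<inter> {..<r} = {0<..<r}" using r by auto
    finally show ?thesis using r by simp
  qed
  have conc: "prob {\<omega> \<in> space M. \<bar>(\<Sum>i\<in>{1..n}. X i \<omega>) - n * r\<bar> \<ge> n * \<epsilon>} \<le> 2 * exp (- 2 * \<epsilon>\<^sup>2) ^ n"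
    if "\<epsilon> > 0" for n \<epsilon>
  proof (cases "n = 0")
    case True
    then show ?thesis using prob_le_1 by (simp add: order_trans[OF prob_le_1])
  next
    case False
    interpret H: Hoeffding_ineq M "{1..n}" X "\<lambda>_. 0" "\<lambda>_. 1" "real n * r"
    proof unfold_locales
      show "indep_vars (\<lambda>_. borel) X {1..n}"
        by (rule indep_vars_subset[OF X_indep]) auto
      show "real n * r \<equiv> \<Sum>i\<in>{1..n}. expectation (X i)"
        by (simp add: expect)
    qed (auto simp: X_def indicator_def)
    have "prob {\<omega> \<in> space M. \<bar>(\<Sum>i\<in>{1..n}. X i \<omega>) - n * r\<bar> \<ge> n * \<epsilon>} \<le>
        2 * exp (- 2 * (n * \<epsilon>)\<^sup>2 / (\<Sum>i\<in>{1..n}. (1 - 0)\<^sup>2))"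
      using False that by (intro H.Hoeffding_ineq_abs_ge) auto
    also have "- 2 * (n * \<epsilon>)\<^sup>2 / (\<Sum>i\<in>{1..n}. (1 - 0)\<^sup>2) = n * (- 2 * \<epsilon>\<^sup>2)"
      using False by (simp add: power2_eq_square)
    finally show ?thesis unfolding exp_of_nat_mult .
  qed
  have close: "AE \<omega> in M. eventually (\<lambda>n. \<bar>(\<Sum>i\<in>{1..n}. X i \<omega>) / real n - r\<bar> < \<epsilon>) sequentially"
    if \<epsilon>: "\<epsilon> > 0" for \<epsilon>
  proof -
    define A where "A n = {\<omega> \<in> space M. \<bar>(\<Sum>i\<in>{1..n}. X i \<omega>) - n * r\<bar> \<ge> n * \<epsilon>}" for n :: nat
    have A: "A n \<in> events" for n unfolding A_def by measurable
    have "summable (\<lambda>n. prob (A n))"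
    proof (rule summable_comparison_test)
      show "\<exists>N. \<forall>n\<ge>N. norm (prob (A n)) \<le> 2 * exp (- 2 * \<epsilon>\<^sup>2) ^ n"
        using conc[OF \<epsilon>] by (auto simp: A_def)
      show "summable (\<lambda>n. 2 * exp (- 2 * \<epsilon>\<^sup>2) ^ n)"
        using \<epsilon> by (intro summable_mult summable_geometric) simp
    qed
    then have "AE \<omega> in M. eventually (\<lambda>n. \<omega> \<in> space M - A n) sequentially"
      using A by (intro borel_cantelli_AE1) (auto simp: emeasure_eq_measure)
    then show ?thesis
    proof eventually_elim
      case (elim \<omega>)
      from elim eventually_gt_at_top[of 0] show ?case
      proof eventually_elim
        case (elim n)
        then have "\<bar>(\<Sum>i\<in>{1..n}. X i \<omega>) - n * r\<bar> < n * \<epsilon>" by (auto simp: A_def)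
        moreover have "(\<Sum>i\<in>{1..n}. X i \<omega>) / real n - r = ((\<Sum>i\<in>{1..n}. X i \<omega>) - n * r) / n"
          using elim by (simp add: diff_divide_distrib)
        ultimately show ?case using elim by (simp add: abs_divide pos_divide_less_eq mult.commute)
      qed
    qed
  qed
  have "AE \<omega> in M. \<forall>k. eventually (\<lambda>n. \<bar>(\<Sum>i\<in>{1..n}. X i \<omega>) / real n - r\<bar> < 1 / real (Suc k)) sequentially"
    using close by (subst AE_all_countable) simp
  then show ?thesis
  proof eventually_elim
    case (elim \<omega>)
    show ?case
    proof (rule tendstoI)
      fix e :: real assume "0 < e"
      then obtain k where k: "1 / real (Suc k) < e" using nat_approx_posE by metis
      show "\<forall>\<^sub>F n in sequentially. dist ((\<Sum>i\<in>{1..n}. indicator {..<r} (\<eta> i \<omega>)) / real n) r < e"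
        using elim[rule_format, of k] by eventually_elim (use k in \<open>simp add: dist_real_def X_def\<close>)
    qed
  qed
qed

text \<open>
  Almost surely the frequencies converge for the countably many rational thresholds. They are
  monotone in the threshold, so convergence extends to all thresholds at once.
\<close>

lemma AE_equidistributed: "AE \<omega> in M. equidistributed_input (with_zero (\<lambda>i. \<eta> i \<omega>))"
proof -
  have "AE \<omega> in M. \<forall>r\<in>\<rat> \<inter> {0..1}. (\<lambda>n. (\<Sum>i\<in>{1..n}. indicator {..<r} (\<eta> i \<omega>)) / real n) \<longlonglongrightarrow> r"
    using AE_frequency countable_rat by (subst AE_ball_countable) auto
  then show ?thesis
    using AE_unit_input
  proof eventually_elim
    case (elim \<omega>)
    define t where "t = with_zero (\<lambda>i. \<eta> i \<omega>)"
    interpret unit_input t using elim by (simp add: t_def)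
    define F where "F x n = real (card {j. j < n \<and> t j < x}) / real n" for x n
    have F_mono: "F x n \<le> F y n" if "x \<le> y" for x y n
      unfolding F_def using that by (intro divide_right_mono of_nat_mono card_mono) auto
    have rat: "F r \<longlonglongrightarrow> r" if r: "r \<in> \<rat>" "0 < r" "r \<le> 1" for r
    proof (rule LIMSEQ_imp_Suc)
      \<comment> \<open>The label of the root is always counted, which adds 1 to the number of the
        \<open>\<eta> j \<omega>\<close> below \<open>r\<close>; this does not affect the limit.\<close>
      have "card {j. j < Suc n \<and> t j < r} = Suc (card {j \<in> {1..n}. \<eta> j \<omega> < r})" for n
      proof -
        have "{j. j < Suc n \<and> t j < r} = insert 0 {j \<in> {1..n}. \<eta> j \<omega> < r}"
          using r(2) by (auto simp: t_def)
        then show ?thesis by simp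
      qed
      moreover have "real (card {j \<in> {1..n}. \<eta> j \<omega> < r}) = (\<Sum>i\<in>{1..n}. indicator {..<r} (\<eta> i \<omega>))" for n
        by (simp add: indicator_def sum.If_cases Int_def)
      ultimately have count: "real (card {j. j < Suc n \<and> t j < r}) =
          (\<Sum>i\<in>{1..n}. indicator {..<r} (\<eta> i \<omega>)) + 1" for n
        by (simp only: of_nat_Suc add.commute)
      have eq: "F r (Suc n) =
          ((\<Sum>i\<in>{1..n}. indicator {..<r} (\<eta> i \<omega>)) / real n) * (real n / real (Suc n)) + 1 / real (Suc n)" for n
        unfolding F_def count by (cases "n = 0") (simp_all add: add_divide_distrib)
      have "(\<lambda>n. ((\<Sum>i\<in>{1..n}. indicator {..<r} (\<eta> i \<omega>)) / real n) * (real n / real (Suc n)) + 1 / real (Suc n))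
          \<longlonglongrightarrow> r * 1 + 0"
        using elim(1) r by (intro tendsto_intros LIMSEQ_n_over_Suc_n lim_1_over_n LIMSEQ_Suc) auto
      then show "(\<lambda>n. F r (Suc n)) \<longlonglongrightarrow> r" by (simp only: eq mult_1_right add_0_right)
    qed
    have "F x \<longlonglongrightarrow> x" if x: "0 \<le> x" "x \<le> 1" for x
    proof (cases "x = 1")
      case True
      have "\<forall>\<^sub>F n in sequentially. F 1 n = 1"
        using eventually_gt_at_top[of 0] by eventually_elim (simp add: F_def t_less_1)
      then show ?thesis unfolding True by (rule tendsto_eventually)
    next
      case False
      then have "x < 1" using x by simp
      show ?thesis
      proof (rule order_tendstoI)
        fix b assume "x < b"
        then obtain r where r: "r \<in> \<rat>" "x < r" "r < min b 1"
          using Rats_dense_in_real[of x "min b 1"] \<open>x < 1\<close> by auto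
        then have "\<forall>\<^sub>F n in sequentially. F r n < b"
          using rat[of r] x by (intro order_tendstoD(2)) auto
        then show "\<forall>\<^sub>F n in sequentially. F x n < b"
          by eventually_elim (use F_mono[of x r] r in \<open>auto intro: le_less_trans\<close>)
      next
        fix a assume "a < x"
        show "\<forall>\<^sub>F n in sequentially. a < F x n"
        proof (cases "0 \<le> a")
          case True
          then obtain r where r: "r \<in> \<rat>" "a < r" "r < x"
            using Rats_dense_in_real[of a x] \<open>a < x\<close> by auto
          then have "\<forall>\<^sub>F n in sequentially. a < F r n"
            using rat[of r] x True by (intro order_tendstoD(1)) auto
          then show ?thesis
            by eventually_elim (use F_mono[of r x] r in \<open>auto intro: less_le_trans\<close>)
        next
          case False
          then have "a < F x n" for n by (simp add: F_def less_le_trans[of a 0])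
          then show ?thesis by simp
        qed
      qed
    qed
    then have "equidistributed_input t"
      by unfold_locales (simp add: F_def[abs_def])
    then show ?case by (simp add: t_def)
  qed
qed

end

section \<open>The Harris chain\<close>

text \<open>
  The sequence of Harris trees as a function of the attachments: \<open>u k\<close> is the node to which node
  \<open>k + 1\<close> is joined, with nodes counted from 1; the subtraction changes to counting from 0.
\<close>

definition tree_sequence :: "(nat \<Rightarrow> nat) \<Rightarrow> nat \<Rightarrow> nat list set" where
  "tree_sequence u = (\<lambda>n\<in>{1..}. word (\<lambda>k. u k - 1) ` {..<n})"

abbreviation attachments :: "(nat \<Rightarrow> nat) measure" where
  "attachments \<equiv> PiM {1..} (\<lambda>i. count_space {1..i})"

lemma tree_sequence_cong: "(\<And>k. 1 \<le> k \<Longrightarrow> u k = v k) \<Longrightarrow> tree_sequence u = tree_sequence v"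
  unfolding tree_sequence_def
  by (intro restrict_ext image_cong refl word_cong) simp

lemma tree_sequence_measurable: "tree_sequence \<in> attachments \<rightarrow>\<^sub>M tree_sequences"
  unfolding tree_sequence_def[abs_def] tree_sequences_def
proof (rule measurable_restrict)
  fix n :: nat assume n: "n \<in> {1..}"
  have harris: "word (\<lambda>k. u k - 1) ` {..<n} \<in> harris_trees" if "u \<in> space attachments" for u
  proof -
    have "recursive_tree (\<lambda>k. u k - 1)"
    proof
      fix k :: nat assume "1 \<le> k"
      then have "u k \<in> {1..k}" using that by (auto simp: space_PiM PiE_iff)
      then show "u k - 1 < k" by auto
    qed
    then show ?thesis using n by (intro recursive_tree.words_harris) auto
  qed
  have "(\<lambda>u. word (\<lambda>k. restrict u {1..n} k - 1) ` {..<n}) \<in> attachments \<rightarrow>\<^sub>M count_space UNIV"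
  proof (rule measurable_compose[where f = "\<lambda>u. restrict u {1..n}" and
        g = "\<lambda>v. word (\<lambda>k. v k - 1) ` {..<n}"])
    show "(\<lambda>u. restrict u {1..n}) \<in> attachments \<rightarrow>\<^sub>M PiM {1..n} (\<lambda>i. count_space {1..i})"
      by (rule measurable_restrict_subset) auto
    show "(\<lambda>v. word (\<lambda>k. v k - 1) ` {..<n}) \<in> PiM {1..n} (\<lambda>i. count_space {1..i}) \<rightarrow>\<^sub>M count_space UNIV"
      by (subst count_space_PiM_finite) auto
  qed
  moreover have "word (\<lambda>k. restrict u {1..n} k - 1) ` {..<n} = word (\<lambda>k. u k - 1) ` {..<n}" for u
    by (intro image_cong refl word_cong) auto
  ultimately have meas: "(\<lambda>u. word (\<lambda>k. u k - 1) ` {..<n}) \<in> attachments \<rightarrow>\<^sub>M count_space UNIV"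
    by simp
  show "(\<lambda>u. word (\<lambda>k. u k - 1) ` {..<n}) \<in> attachments \<rightarrow>\<^sub>M count_space harris_trees"
    unfolding measurable_count_space_eq_countable[OF countable_harris_trees]
    using harris measurable_sets[OF meas] by auto
qed

text \<open>
  The recursive tree at time \<open>n\<close> has the attachments \<open>U 1, \<dots>, U (n - 1)\<close> as its edges, so the Harris
  chain is \<open>tree_sequence\<close> applied to independent uniform attachments.
\<close>

lemma harris_chain_law:
  assumes "harris_chain N X"
  shows "(\<lambda>\<omega>. \<lambda>n\<in>{1..}. X n \<omega>) \<in> N \<rightarrow>\<^sub>M tree_sequences"
    and "distr N tree_sequences (\<lambda>\<omega>. \<lambda>n\<in>{1..}. X n \<omega>) =
      distr (PiM {1..} (\<lambda>i. uniform_count_measure {1..i})) tree_sequences tree_sequence"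
proof -
  from assms obtain Y where "rrt_chain N Y"
    and X_all: "\<forall>n\<ge>1. \<forall>\<omega>\<in>space N. X n \<omega> = Psi (Y n \<omega>)"
    unfolding harris_chain_def by (elim exE conjE)
  then obtain U where "prob_space N"
    and indep: "prob_space.indep_vars N (\<lambda>n. count_space {1..n}) U {1..}"
    and law_all: "\<forall>n\<ge>1. distr N (count_space {1..n}) (U n) = uniform_count_measure {1..n}"
    and Y_all: "\<forall>\<omega>\<in>space N. Y 1 \<omega> = {} \<and> (\<forall>n\<ge>1. Y (Suc n) \<omega> = insert (U n \<omega>, Suc n) (Y n \<omega>))"
    unfolding rrt_chain_def by (elim exE conjE)
  note X = X_all[rule_format]
  note law = law_all[rule_format]
  note Y = Y_all[rule_format, THEN conjunct1] Y_all[rule_format, THEN conjunct2, rule_format]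
  interpret prob_space N by fact
  have U: "U n \<in> N \<rightarrow>\<^sub>M count_space {1..n}" if "1 \<le> n" for n
    using indep that by (auto simp: indep_vars_def)
  let ?U = "\<lambda>\<omega>. \<lambda>i\<in>{1..}. U i \<omega>"
  have U_meas: "?U \<in> N \<rightarrow>\<^sub>M attachments"
    by (intro measurable_restrict U) simp
  have U_law: "distr N attachments ?U = PiM {1..} (\<lambda>i. uniform_count_measure {1..i})"
  proof -
    have "distr N attachments ?U = PiM {1..} (\<lambda>i. distr N (count_space {1..i}) (U i))"
      using indep_vars_iff_distr_eq_PiM'[where I = "{1..}" and X = U and M' = "\<lambda>n. count_space {1..n}"]
        U indep by auto
    also have "\<dots> = PiM {1..} (\<lambda>i. uniform_count_measure {1..i})"
      by (intro PiM_cong law) auto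
    finally show ?thesis .
  qed
  have X_eq: "(\<lambda>n\<in>{1..}. X n \<omega>) = tree_sequence (?U \<omega>)" if \<omega>: "\<omega> \<in> space N" for \<omega>
  proof -
    define p where "p k = U k \<omega> - 1" for k
    have U_in: "1 \<le> U k \<omega>" "U k \<omega> \<le> k" if "1 \<le> k" for k
      using measurable_space[OF U[OF that] \<omega>] by auto
    interpret recursive_tree p
      by unfold_locales (use U_in in \<open>fastforce simp: p_def\<close>)
    have "Y n \<omega> = {(Suc (p k), Suc k) | k. 1 \<le> k \<and> k < n}" if "1 \<le> n" for n
      using that
    proof (induction n rule: dec_induct)
      case base
      show ?case using Y(1)[OF \<omega>] by simp
    next
      case (step n)
      have "Suc (p n) = U n \<omega>" using U_in[OF step(1)] by (simp add: p_def)
      moreover have "{(Suc (p k), Suc k) | k. 1 \<le> k \<and> k < Suc n} =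
          insert (Suc (p n), Suc n) {(Suc (p k), Suc k) | k. 1 \<le> k \<and> k < n}"
        using step(1) by (auto simp: less_Suc_eq)
      ultimately show ?case
        unfolding Y(2)[OF \<omega> step(1)] step.IH by (simp only:)
    qed
    then have "X n \<omega> = word p ` {..<n}" if "1 \<le> n" for n
      using X[OF that \<omega>] Psi_eq_words[OF that] that by (simp only:)
    then have "(\<lambda>n\<in>{1..}. X n \<omega>) = tree_sequence (\<lambda>i. U i \<omega>)"
      unfolding tree_sequence_def p_def[abs_def] by (intro restrict_ext) simp
    also have "\<dots> = tree_sequence (?U \<omega>)"
      by (rule tree_sequence_cong) simp
    finally show ?thesis .
  qed
  have comp: "(\<lambda>\<omega>. tree_sequence (?U \<omega>)) \<in> N \<rightarrow>\<^sub>M tree_sequences"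
    by (rule measurable_compose[OF U_meas tree_sequence_measurable])
  then show "(\<lambda>\<omega>. \<lambda>n\<in>{1..}. X n \<omega>) \<in> N \<rightarrow>\<^sub>M tree_sequences"
    by (subst measurable_cong[OF X_eq]) auto
  have "distr N tree_sequences (\<lambda>\<omega>. \<lambda>n\<in>{1..}. X n \<omega>) =
      distr N tree_sequences (tree_sequence \<circ> ?U)"
    by (rule distr_cong) (simp_all only: X_eq comp_def)
  also have "\<dots> = distr (distr N attachments ?U) tree_sequences tree_sequence"
    by (rule distr_distr[OF tree_sequence_measurable U_meas, symmetric])
  finally show "distr N tree_sequences (\<lambda>\<omega>. \<lambda>n\<in>{1..}. X n \<omega>) =
      distr (PiM {1..} (\<lambda>i. uniform_count_measure {1..i})) tree_sequences tree_sequence"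
    by (simp only: U_law)
qed

context uniform_input
begin

lemma RT_sequence_measurable: "(\<lambda>\<omega>. \<lambda>n\<in>{1..}. RT (\<lambda>i. \<eta> i \<omega>) n) \<in> M \<rightarrow>\<^sub>M tree_sequences"
  unfolding tree_sequences_def
  by (intro measurable_restrict RT_measurable \<eta>_measurable)

text \<open>
  Almost surely RT is \<open>tree_sequence\<close> applied to the predecessors, and these are distributed as
  the attachments of a random recursive tree.
\<close>

lemma RT_law:
  "distr M tree_sequences (\<lambda>\<omega>. \<lambda>n\<in>{1..}. RT (\<lambda>i. \<eta> i \<omega>) n) =
    distr (PiM {1..} (\<lambda>i. uniform_count_measure {1..i})) tree_sequences tree_sequence"
proof -
  define V where "V i \<omega> = Suc (predecessor (with_zero (\<lambda>i. \<eta> i \<omega>)) i)" for i \<omega>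
  let ?V = "\<lambda>\<omega>. \<lambda>i\<in>{1..}. V i \<omega>"
  have V: "V i \<in> M \<rightarrow>\<^sub>M count_space {1..i}" if "1 \<le> i" for i
  proof -
    have "(\<lambda>\<omega>. predecessor (with_zero (\<lambda>i. \<eta> i \<omega>)) i) \<in> M \<rightarrow>\<^sub>M count_space UNIV"
      by (intro predecessor_measurable with_zero_measurable \<eta>_measurable)
    then have "V i \<in> M \<rightarrow>\<^sub>M count_space UNIV"
      unfolding V_def by measurable
    moreover have "V i \<omega> \<in> {1..i}" for \<omega>
      using recursive_tree.parent_less[OF recursive_tree_predecessor that] by (simp add: V_def Suc_le_eq)
    ultimately show ?thesis
      unfolding measurable_count_space_eq2_countable by auto
  qed
  have V_meas: "?V \<in> M \<rightarrow>\<^sub>M attachments"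
    by (intro measurable_restrict V) simp
  have dist: "AE \<omega> in M. distinct_input (with_zero (\<lambda>i. \<eta> i \<omega>))"
    using AE_unit_input by eventually_elim (simp add: unit_input_def)
  have V_law: "distr M attachments ?V = PiM {1..} (\<lambda>i. uniform_count_measure {1..i})"
    by (intro uniform_sequence_law V predecessor_uniform[OF indep uniform dist]) (auto simp: V_def)
  have "distr M tree_sequences (\<lambda>\<omega>. \<lambda>n\<in>{1..}. RT (\<lambda>i. \<eta> i \<omega>) n) =
      distr M tree_sequences (tree_sequence \<circ> ?V)"
  proof (rule distr_cong_AE)
    show "AE \<omega> in M. (\<lambda>n\<in>{1..}. RT (\<lambda>i. \<eta> i \<omega>) n) = (tree_sequence \<circ> ?V) \<omega>"
      using dist
    proof eventually_elim
      case (elim \<omega>)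
      interpret distinct_input "with_zero (\<lambda>i. \<eta> i \<omega>)" by fact
      have "(\<lambda>n\<in>{1..}. RT (\<lambda>i. \<eta> i \<omega>) n) = tree_sequence (\<lambda>i. V i \<omega>)"
        unfolding tree_sequence_def V_def using RT_eq_words by (intro restrict_ext) simp
      also have "\<dots> = tree_sequence (?V \<omega>)"
        by (rule tree_sequence_cong) simp
      finally show ?case by simp
    qed
    show "tree_sequence \<circ> ?V \<in> M \<rightarrow>\<^sub>M tree_sequences"
      by (rule measurable_comp[OF V_meas tree_sequence_measurable])
  qed (simp_all only: RT_sequence_measurable refl)
  also have "\<dots> = distr (distr M attachments ?V) tree_sequences tree_sequence"
    by (rule distr_distr[OF tree_sequence_measurable V_meas, symmetric])
  finally show ?thesis by (simp only: V_law)
qed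

end

section \<open>Convergence in the Doob-Martin topology\<close>

text \<open>
  The topology is generated by the preimages of open sets under the evaluations at cylinders, and
  being eventually in a set is preserved by finite intersections and by unions.
\<close>

lemma limitin_doob_martinI:
  assumes \<mu>: "\<mu> \<in> space (prob_algebra ext_words_algebra)"
    and f: "\<And>n. f n \<in> space (prob_algebra ext_words_algebra)"
    and lim: "\<And>u. u \<in> words \<Longrightarrow> ((\<lambda>n. measure (f n) (cyl u)) \<longlongrightarrow> measure \<mu> (cyl u)) F"
  shows "limitin doob_martin f \<mu> F"
  unfolding limitin_def
proof (intro conjI allI impI)
  have "[] \<in> words" by (simp add: words_def)
  then show "\<mu> \<in> topspace doob_martin"
    unfolding doob_martin_def topology_generated_by_topspace using \<mu> by blast
  fix U assume U: "openin doob_martin U \<and> \<mu> \<in> U"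
  then have "generate_topology_on {{\<mu> \<in> space (prob_algebra ext_words_algebra). measure \<mu> (cyl u) \<in> S} | u S.
        u \<in> words \<and> open (S :: real set)} U"
    unfolding doob_martin_def by (simp only: openin_topology_generated_by_iff)
  then show "\<forall>\<^sub>F n in F. f n \<in> U"
    using U[THEN conjunct2]
  proof induction
    case (UN K)
    then obtain k where "k \<in> K" "\<mu> \<in> k" by auto
    then have "\<forall>\<^sub>F n in F. f n \<in> k" using UN.IH by blast
    then show ?case by eventually_elim (use \<open>k \<in> K\<close> in auto)
  next
    case (Int a b)
    then have "\<forall>\<^sub>F n in F. f n \<in> a" "\<forall>\<^sub>F n in F. f n \<in> b" by auto
    then show ?case by eventually_elim auto
  next
    case (Basis s)
    then obtain u S where "u \<in> words" "open S"
      and s: "s = {\<mu> \<in> space (prob_algebra ext_words_algebra). measure \<mu> (cyl u) \<in> S}"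
      by auto
    then have "\<forall>\<^sub>F n in F. measure (f n) (cyl u) \<in> S"
      using Basis.prems by (intro topological_tendstoD[OF lim]) auto
    then show ?case by eventually_elim (simp add: s f)
  qed simp
qed

lemma Word_measurable:
  assumes "x \<in> harris_trees"
  shows "Word \<in> uniform_count_measure x \<rightarrow>\<^sub>M ext_words_algebra"
proof -
  have "Word \<in> count_space x \<rightarrow>\<^sub>M ext_words_algebra"
    using harris_treesD(3)[OF assms] Word_in_ext_words
    by (auto simp: space_ext_words_algebra)
  then show ?thesis
    unfolding measurable_cong_sets[OF sets_uniform_count_measure_count_space refl] .
qed

lemma tree_measure_in_space:
  assumes "x \<in> harris_trees"
  shows "tree_measure x \<in> space (prob_algebra ext_words_algebra)"
proof -
  have "prob_space (uniform_count_measure x)"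
    using harris_treesD(1,2)[OF assms] by (rule prob_space_uniform_count_measure)
  then show ?thesis
    unfolding tree_measure_def
    by (simp add: space_prob_algebra prob_space.prob_space_distr Word_measurable assms)
qed

lemma measure_tree_measure:
  assumes x: "x \<in> harris_trees" and u: "u \<in> words"
  shows "measure (tree_measure x) (cyl u) = real (card {v \<in> x. prefix u v}) / real (card x)"
proof -
  have "measure (tree_measure x) (cyl u) =
      measure (uniform_count_measure x) (Word -` cyl u \<inter> space (uniform_count_measure x))"
    unfolding tree_measure_def by (rule measure_distr[OF Word_measurable[OF x] cyl_in_sets[OF u]])
  also have "Word -` cyl u \<inter> space (uniform_count_measure x) = {v \<in> x. prefix u v}"
    using harris_treesD(3)[OF x] Word_in_ext_words by (auto simp: cyl_def space_uniform_count_measure)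
  finally show ?thesis
    using harris_treesD(1)[OF x] by (simp add: measure_uniform_count_measure)
qed

theorem theorem1:
  fixes M :: "'a measure" and \<eta> :: "nat \<Rightarrow> 'a \<Rightarrow> real"
  assumes "prob_space M"
    and "prob_space.indep_vars M (\<lambda>_. borel) \<eta> {1..}"
    and "\<And>i. i \<ge> 1 \<Longrightarrow> distr M lborel (\<eta> i) = uniform_measure lborel {0<..<1}"
  shows "((\<lambda>\<omega>. \<lambda>n\<in>{1..}. RT (\<lambda>i. \<eta> i \<omega>) n) \<in> M \<rightarrow>\<^sub>M tree_sequences \<and>
      (\<forall>(N :: 'b measure) X. harris_chain N X \<longrightarrow>
        (\<lambda>\<omega>. \<lambda>n\<in>{1..}. X n \<omega>) \<in> N \<rightarrow>\<^sub>M tree_sequences \<and>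
        distr M tree_sequences (\<lambda>\<omega>. \<lambda>n\<in>{1..}. RT (\<lambda>i. \<eta> i \<omega>) n) =
        distr N tree_sequences (\<lambda>\<omega>. \<lambda>n\<in>{1..}. X n \<omega>)))
    \<and>
    (\<exists>X_inf \<in> M \<rightarrow>\<^sub>M prob_algebra ext_words_algebra.
      AE \<omega> in M.
        limitin doob_martin (\<lambda>n. tree_measure (RT (\<lambda>i. \<eta> i \<omega>) n)) (X_inf \<omega>) sequentially \<and>
        (\<forall>u\<in>words. measure (X_inf \<omega>) (cyl u) =
           (let t = with_zero (\<lambda>i. \<eta> i \<omega>)
            in order_stat t (tau t u) (kappa t u + 1) - t (tau t u))))"
proof -
  interpret prob_space M by fact
  have lborel_borel: "distr M borel (\<eta> i) = distr M lborel (\<eta> i)" for i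
    by (rule distr_cong) simp_all
  interpret uniform_input M \<eta>
    using assms(2,3) by unfold_locales (simp_all add: lborel_borel)
  define S where "S \<omega> = (\<lambda>i. \<eta> i \<omega>)" for \<omega>
  define freq where "freq u n \<omega> = real (card {v \<in> RT (S \<omega>) n. prefix u v}) / real n" for u n \<omega>
  obtain Z where Z: "Z \<in> null_sets M"
    and good: "\<And>\<omega>. \<omega> \<in> space M - Z \<Longrightarrow> equidistributed_input (with_zero (S \<omega>))"
    using AE_E3[OF AE_equidistributed] unfolding S_def by metis
  \<comment> \<open>The masses are prescribed as limits of frequencies because these are visibly
    measurable in \<open>\<omega>\<close>.\<close>
  define limit_measure where "limit_measure \<omega> = (SOME \<mu>. \<mu> \<in> space (prob_algebra ext_words_algebra) \<and>
      (\<forall>u\<in>words. measure \<mu> (cyl u) = lim (\<lambda>n. freq u n \<omega>)))" for \<omega>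
  \<comment> \<open>On the null set \<open>Z\<close> an arbitrary fixed probability measure is used.\<close>
  define X_inf where "X_inf \<omega> = (if \<omega> \<in> Z then return ext_words_algebra (Word []) else limit_measure \<omega>)" for \<omega>
  have limit: "limit_measure \<omega> \<in> space (prob_algebra ext_words_algebra)"
      "u \<in> words \<Longrightarrow> measure (limit_measure \<omega>) (cyl u) = lim (\<lambda>n. freq u n \<omega>)"
      "u \<in> words \<Longrightarrow> (\<lambda>n. freq u n \<omega>) \<longlonglongrightarrow> measure (limit_measure \<omega>) (cyl u)"
      "u \<in> words \<Longrightarrow> measure (limit_measure \<omega>) (cyl u) =
        (let t = with_zero (S \<omega>) in order_stat t (tau t u) (kappa t u + 1) - t (tau t u))"
    if \<omega>: "\<omega> \<in> space M - Z" for \<omega> u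
  proof -
    define t where "t = with_zero (S \<omega>)"
    interpret equidistributed_input t using good[OF \<omega>] by (simp add: t_def)
    have freq: "(\<lambda>n. freq (W m) n \<omega>) \<longlonglongrightarrow> upper m - t m" for m
      using subtree_frequency[of m] unfolding freq_def t_def RT_with_zero .
    obtain \<mu> where \<mu>: "\<mu> \<in> space (prob_algebra ext_words_algebra)"
      "\<And>m. measure \<mu> (cyl (W m)) = upper m - t m"
      using exists_limit_measure by blast
    have "\<exists>\<mu>. \<mu> \<in> space (prob_algebra ext_words_algebra) \<and>
        (\<forall>u\<in>words. measure \<mu> (cyl u) = lim (\<lambda>n. freq u n \<omega>))"
      using \<mu> limI[OF freq] word_appears by metis
    from someI_ex[OF this] have L: "limit_measure \<omega> \<in> space (prob_algebra ext_words_algebra)"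
      "\<And>u. u \<in> words \<Longrightarrow> measure (limit_measure \<omega>) (cyl u) = lim (\<lambda>n. freq u n \<omega>)"
      by (auto simp: limit_measure_def)
    show "limit_measure \<omega> \<in> space (prob_algebra ext_words_algebra)" by (rule L)
    assume u: "u \<in> words"
    then obtain m where m: "u = W m" using word_appears by blast
    show "measure (limit_measure \<omega>) (cyl u) = lim (\<lambda>n. freq u n \<omega>)" by (rule L(2)[OF u])
    show "(\<lambda>n. freq u n \<omega>) \<longlonglongrightarrow> measure (limit_measure \<omega>) (cyl u)"
      unfolding L(2)[OF u] unfolding m limI[OF freq] by (rule freq)
    show "measure (limit_measure \<omega>) (cyl u) =
        (let t = with_zero (S \<omega>) in order_stat t (tau t u) (kappa t u + 1) - t (tau t u))"
      unfolding L(2)[OF u] unfolding m limI[OF freq] t_def[symmetric] Let_def tau_word order_stat_eq_upper ..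
  qed
  have "Word [] \<in> ext_words" by (rule Word_in_ext_words) (simp add: words_def)
  then have default: "return ext_words_algebra (Word []) \<in> space (prob_algebra ext_words_algebra)"
    by (simp add: space_prob_algebra prob_space_return space_ext_words_algebra)
  have X_inf_space: "X_inf \<omega> \<in> space (prob_algebra ext_words_algebra)" if "\<omega> \<in> space M" for \<omega>
    using limit(1) default that by (auto simp: X_inf_def)
  have Z_sets[measurable]: "Z \<in> sets M" using Z by auto
  have X_inf: "X_inf \<in> M \<rightarrow>\<^sub>M prob_algebra ext_words_algebra"
  proof (rule measurable_prob_algebra_generated[OF sets_ext_words_algebra' Int_stable_cyl])
    show "insert {} (cyl ` words) \<subseteq> Pow ext_words" using cyl_subset by auto
    show "prob_space (X_inf \<omega>)" "sets (X_inf \<omega>) = sets ext_words_algebra" if "\<omega> \<in> space M" for \<omega>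
      using X_inf_space[OF that] by (simp_all add: space_prob_algebra)
    fix A assume "A \<in> insert {} (cyl ` words)"
    then consider "A = {}" | u where "u \<in> words" "A = cyl u" by auto
    then show "(\<lambda>\<omega>. emeasure (X_inf \<omega>) A) \<in> borel_measurable M"
    proof cases
      case 1
      then show ?thesis by simp
    next
      case (2 u)
      have [measurable]: "freq u n \<in> borel_measurable M" for n
        unfolding freq_def S_def
        by (rule measurable_compose[OF RT_measurable[OF \<eta>_measurable]]) auto
      have "emeasure (X_inf \<omega>) A = (if \<omega> \<in> Z then indicator A (Word [])
          else ennreal (lim (\<lambda>n. freq u n \<omega>)))" if \<omega>: "\<omega> \<in> space M" for \<omega>
      proof (cases "\<omega> \<in> Z")
        case True
        then show ?thesis by (simp add: X_inf_def 2 cyl_in_sets)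
      next
        case False
        then have L: "limit_measure \<omega> \<in> space (prob_algebra ext_words_algebra)"
          "measure (limit_measure \<omega>) A = lim (\<lambda>n. freq u n \<omega>)"
          using limit(1)[of \<omega>] limit(2)[of \<omega> u] \<omega> 2 by auto
        interpret L: prob_space "limit_measure \<omega>"
          using L(1) by (simp add: space_prob_algebra)
        show ?thesis
          using False L(2) by (simp add: X_inf_def L.emeasure_eq_measure)
      qed
      moreover have "(\<lambda>\<omega>. if \<omega> \<in> Z then indicator A (Word [])
          else ennreal (lim (\<lambda>n. freq u n \<omega>))) \<in> borel_measurable M"
        by measurable
      ultimately show ?thesis by (subst measurable_cong) auto
    qed
  qed
  have convergence: "AE \<omega> in M. limitin doob_martin (\<lambda>n. tree_measure (RT (S \<omega>) n)) (X_inf \<omega>) sequentially \<and>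
        (\<forall>u\<in>words. measure (X_inf \<omega>) (cyl u) =
           (let t = with_zero (S \<omega>)
            in order_stat t (tau t u) (kappa t u + 1) - t (tau t u)))"
  proof (rule AE_I')
    show "Z \<in> null_sets M" by fact
    have "limitin doob_martin (\<lambda>n. tree_measure (RT (S \<omega>) n)) (X_inf \<omega>) sequentially"
      if \<omega>: "\<omega> \<in> space M - Z" for \<omega>
    proof (rule limitin_doob_martinI)
      show "X_inf \<omega> \<in> space (prob_algebra ext_words_algebra)"
        using X_inf_space \<omega> by auto
      show "tree_measure (RT (S \<omega>) n) \<in> space (prob_algebra ext_words_algebra)" for n
        by (rule tree_measure_in_space[OF RT_harris])
      fix u assume u: "u \<in> words"
      interpret equidistributed_input "with_zero (S \<omega>)" using good[OF \<omega>] .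
      have "\<forall>\<^sub>F n in sequentially. freq u n \<omega> = measure (tree_measure (RT (S \<omega>) n)) (cyl u)"
        using eventually_ge_at_top[of 1]
      proof eventually_elim
        case (elim n)
        have "card (RT (S \<omega>) n) = n"
          using RT_eq_words[OF refl elim] by (simp add: card_image inj_on_def word_eq_iff)
        then show ?case
          by (simp add: measure_tree_measure[OF RT_harris u] freq_def)
      qed
      moreover have "(\<lambda>n. freq u n \<omega>) \<longlonglongrightarrow> measure (X_inf \<omega>) (cyl u)"
        using limit(3)[OF \<omega> u] \<omega> by (simp add: X_inf_def)
      ultimately show "(\<lambda>n. measure (tree_measure (RT (S \<omega>) n)) (cyl u)) \<longlonglongrightarrow> measure (X_inf \<omega>) (cyl u)"
        by (rule Lim_transform_eventually[rotated])
    qed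
    moreover have "measure (X_inf \<omega>) (cyl u) =
           (let t = with_zero (S \<omega>) in order_stat t (tau t u) (kappa t u + 1) - t (tau t u))"
      if \<omega>: "\<omega> \<in> space M - Z" and "u \<in> words" for \<omega> u
      using limit(4)[OF that] \<omega> by (simp add: X_inf_def)
    ultimately show "{\<omega> \<in> space M. \<not> (limitin doob_martin (\<lambda>n. tree_measure (RT (S \<omega>) n)) (X_inf \<omega>) sequentially \<and>
        (\<forall>u\<in>words. measure (X_inf \<omega>) (cyl u) =
           (let t = with_zero (S \<omega>)
            in order_stat t (tau t u) (kappa t u + 1) - t (tau t u))))} \<subseteq> Z"
      by blast
  qed
  show ?thesis
  proof (intro conjI allI impI bexI[OF _ X_inf])
    show "(\<lambda>\<omega>. \<lambda>n\<in>{1..}. RT (\<lambda>i. \<eta> i \<omega>) n) \<in> M \<rightarrow>\<^sub>M tree_sequences"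
      by (rule RT_sequence_measurable)
    fix N :: "'b measure" and X
    assume X: "harris_chain N X"
    show "(\<lambda>\<omega>. \<lambda>n\<in>{1..}. X n \<omega>) \<in> N \<rightarrow>\<^sub>M tree_sequences"
      by (rule harris_chain_law(1)[OF X])
    show "distr M tree_sequences (\<lambda>\<omega>. \<lambda>n\<in>{1..}. RT (\<lambda>i. \<eta> i \<omega>) n) =
        distr N tree_sequences (\<lambda>\<omega>. \<lambda>n\<in>{1..}. X n \<omega>)"
      unfolding RT_law harris_chain_law(2)[OF X] ..
  qed (rule convergence[unfolded S_def])
qed

end
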